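(* Let $g:\mathbb{R}^n\to\mathbb{R}^m$ be computable, open, and continuously differentiable with computable derivative $g'$. Then the image mapping $R\mapsto g[R]$ on bounded regular closed sets $R\subseteq\mathbb{R}^n$ is $(\bar\theta^n_<\to\bar\theta^m_<)$-computable.
   Context: A set $R\subseteq\mathbb{R}^d$ is regular (closed) if it equals the closure of its interior. $\theta^d_<$ represents open subsets of $\mathbb{R}^d$ by lists of rational centers and radii of open balls whose union is the set; $\bar\theta^d_<$ represents a regular closed set $R$ by a $\theta^d_<$-name of some open $U$ with $\overline{U}=R$ (equivalently, a list of open rational balls whose union is dense in $R$). Computability in the Type-2 sense (Weihrauch) with Cauchy representation for real vectors. *)

theory Defs
  imports "HOL-Analysis.Analysis" "HOL-Library.Nat_Bijection" "HOL-Library.Countable"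
begin

datatype rf = Zero | Succ | Proj nat | Orc | Comp rf "rf list" | Prec rf rf | Mu rf

inductive rf_eval :: "(nat \<Rightarrow> nat) \<Rightarrow> rf \<Rightarrow> nat list \<Rightarrow> nat \<Rightarrow> bool" for p where
  zero: "rf_eval p Zero xs 0"
| succ: "rf_eval p Succ (x # xs) (Suc x)"
| proj: "i < length xs \<Longrightarrow> rf_eval p (Proj i) xs (xs ! i)"
| orc: "rf_eval p Orc (x # xs) (p x)"
| comp: "list_all2 (\<lambda>g y. rf_eval p g xs y) gs ys \<Longrightarrow> rf_eval p f ys z
          \<Longrightarrow> rf_eval p (Comp f gs) xs z"
| prec0: "rf_eval p f xs y \<Longrightarrow> rf_eval p (Prec f g) (0 # xs) y"
| precS: "rf_eval p (Prec f g) (n # xs) y \<Longrightarrow> rf_eval p g (y # n # xs) z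
          \<Longrightarrow> rf_eval p (Prec f g) (Suc n # xs) z"
| mu: "rf_eval p f (y # xs) 0 \<Longrightarrow> (\<forall>i<y. \<exists>v. 0 < v \<and> rf_eval p f (i # xs) v)
          \<Longrightarrow> rf_eval p (Mu f) xs y"

text \<open>A representation of X is given as a naming relation: delta p x means p is a name of x.
  f is (delta_X, delta_Y)-computable on the subset A iff some oracle program c, on every
  name p of any x in A, computes (k \<mapsto> output) a total sequence q that is a name of f x.\<close>
definition type2_computable ::
  "((nat \<Rightarrow> nat) \<Rightarrow> 'x \<Rightarrow> bool) \<Rightarrow> ((nat \<Rightarrow> nat) \<Rightarrow> 'y \<Rightarrow> bool) \<Rightarrow> ('x \<Rightarrow> 'y) \<Rightarrow> 'x set \<Rightarrow> bool"
  where "type2_computable \<delta>X \<delta>Y f A \<longleftrightarrow>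
    (\<exists>c. \<forall>p x. x \<in> A \<longrightarrow> \<delta>X p x \<longrightarrow>
        (\<exists>q. (\<forall>k. rf_eval p c [k] (q k)) \<and> \<delta>Y q (f x)))"

definition rat_dec :: "nat \<Rightarrow> real" where
  "rat_dec k = (case prod_decode k of (a, b) \<Rightarrow> of_int (int_decode a) / of_nat (b + 1))"

definition nth0 :: "nat list \<Rightarrow> nat \<Rightarrow> nat" where
  "nth0 l i = (if i < length l then l ! i else 0)"

text \<open>Rational vectors: coordinate i is read from list position to_nat i (a fixed finite table).\<close>
definition vec_dec :: "nat \<Rightarrow> real ^ 'n::finite" where
  "vec_dec k = (\<chi> i. rat_dec (nth0 (list_decode k) (to_nat i)))"

definition mat_dec :: "nat \<Rightarrow> real ^ 'n::finite ^ 'm::finite" where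
  "mat_dec k = (\<chi> i. vec_dec (nth0 (list_decode k) (to_nat i)))"

definition cauchy_name :: "(nat \<Rightarrow> 'a::metric_space) \<Rightarrow> (nat \<Rightarrow> nat) \<Rightarrow> 'a \<Rightarrow> bool" where
  "cauchy_name \<nu> p x \<longleftrightarrow> (\<forall>k. dist (\<nu> (p k)) x \<le> (1/2) ^ k)"

abbreviation rho :: "(nat \<Rightarrow> nat) \<Rightarrow> real ^ 'n::finite \<Rightarrow> bool" where
  "rho \<equiv> cauchy_name vec_dec"

abbreviation rho_mat :: "(nat \<Rightarrow> nat) \<Rightarrow> real ^ 'n::finite ^ 'm::finite \<Rightarrow> bool" where
  "rho_mat \<equiv> cauchy_name mat_dec"

text \<open>Rational open ball with code j: center vec_dec a, radius rat_dec b (empty if radius \<le> 0).\<close>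
definition ball_dec :: "nat \<Rightarrow> (real ^ 'n::finite) set" where
  "ball_dec j = (case prod_decode j of (a, b) \<Rightarrow> ball (vec_dec a) (rat_dec b))"

definition theta_lt :: "(nat \<Rightarrow> nat) \<Rightarrow> (real ^ 'n::finite) set \<Rightarrow> bool" where
  "theta_lt p U \<longleftrightarrow> U = (\<Union>k. ball_dec (p k))"

definition theta_bar_lt :: "(nat \<Rightarrow> nat) \<Rightarrow> (real ^ 'n::finite) set \<Rightarrow> bool" where
  "theta_bar_lt p R \<longleftrightarrow> (\<exists>U. theta_lt p U \<and> closure U = R)"

definition regular_closed :: "'a::topological_space set \<Rightarrow> bool" where
  "regular_closed R \<longleftrightarrow> R = closure (interior R)"

end

theory Submission
  imports Defs
begin

text \<open>A program for \<open>g'\<close>, run on the constant name of a rational point \<open>q\<close>, reads only finitely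
  many entries of that name, so its output approximates \<open>g'\<close> on an explicit ball around \<open>q\<close>. If
  this approximate derivative has an approximate rational right inverse, a contraction argument
  yields an explicit ball around \<open>g q\<close> that is covered by the image of that ball. All of these
  conditions are decidable, so the program searches through all tuples of rational data and
  outputs the balls thus certified whenever the ball around \<open>q\<close> lies in a listed ball of \<open>U\<close>.
  The certified balls are dense in \<open>g U\<close> because the points with surjective derivative are dense:
  near a point of locally maximal rank, the constant rank theorem would otherwise make the image of
  the open map \<open>g\<close> a graph over a proper subspace.  For bounded \<open>U\<close>, the closure of \<open>g U\<close> is
  the image of the closure of \<open>U\<close> by compactness.\<close>

section \<open>Total computable functions with an oracle\<close>

lemma rf_eval_Prec:
  assumes "rf_eval p f xs A" "\<And>n y. rf_eval p g (y # n # xs) (G n y)"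
  shows "rf_eval p (Prec f g) (n # xs) (rec_nat A G n)"
  by (induction n) (auto intro: rf_eval.intros assms)

lemma rf_eval_Proj:
  assumes "i < length xs" "y = xs ! i"
  shows "rf_eval p (Proj i) xs y"
  using rf_eval.proj[OF assms(1)] assms(2) by simp

lemma rf_eval_Comp1:
  assumes "rf_eval p g xs y" "rf_eval p f [y] z"
  shows "rf_eval p (Comp f [g]) xs z"
  by (rule rf_eval.comp[of _ _ _ "[y]"]) (use assms in auto)

lemma rf_eval_Comp2:
  assumes "rf_eval p g1 xs y1" "rf_eval p g2 xs y2" "rf_eval p f [y1, y2] z"
  shows "rf_eval p (Comp f [g1, g2]) xs z"
  by (rule rf_eval.comp[of _ _ _ "[y1, y2]"]) (use assms in auto)

text \<open>All functions are unary; further arguments are passed through the pairing.  The oracle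
  \<open>p\<close> is an argument of the function, so that totality is required for every oracle.\<close>

definition total_computable :: "((nat \<Rightarrow> nat) \<Rightarrow> nat \<Rightarrow> nat) \<Rightarrow> bool" where
  "total_computable F \<longleftrightarrow> (\<exists>c. \<forall>p x. rf_eval p c [x] (F p x))"

text \<open>Primitive recursion and search act on argument lists, so the arithmetic behind the
  coding of pairs is first built with two list arguments. These functions ignore the oracle.\<close>

definition total_computable2 :: "(nat \<Rightarrow> nat \<Rightarrow> nat) \<Rightarrow> bool" where
  "total_computable2 b \<longleftrightarrow> (\<exists>c. \<forall>p x y. rf_eval p c [x, y] (b x y))"

lemma total_computable_comp:
  assumes "total_computable F" "total_computable G"
  shows "total_computable (\<lambda>p x. F p (G p x))"
proof -
  obtain c d where "\<And>p x. rf_eval p c [x] (F p x)" "\<And>p x. rf_eval p d [x] (G p x)"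
    using assms unfolding total_computable_def by blast
  then have "rf_eval p (Comp c [d]) [x] (F p (G p x))" for p x
    by (intro rf_eval_Comp1)
  then show ?thesis unfolding total_computable_def by blast
qed

lemma total_computable_comp2:
  assumes "total_computable2 b" "total_computable F" "total_computable G"
  shows "total_computable (\<lambda>p x. b (F p x) (G p x))"
proof -
  obtain e c d where "\<And>p x y. rf_eval p e [x, y] (b x y)"
    "\<And>p x. rf_eval p c [x] (F p x)" "\<And>p x. rf_eval p d [x] (G p x)"
    using assms unfolding total_computable_def total_computable2_def by blast
  then have "rf_eval p (Comp e [c, d]) [x] (b (F p x) (G p x))" for p x
    by (intro rf_eval_Comp2)
  then show ?thesis unfolding total_computable_def by blast
qed

lemma total_computable2_comp2:
  assumes "total_computable2 b" "total_computable2 F" "total_computable2 G"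
  shows "total_computable2 (\<lambda>x y. b (F x y) (G x y))"
proof -
  obtain e c d where "\<And>p x y. rf_eval p e [x, y] (b x y)"
    "\<And>p x y. rf_eval p c [x, y] (F x y)" "\<And>p x y. rf_eval p d [x, y] (G x y)"
    using assms unfolding total_computable2_def by blast
  then have "rf_eval p (Comp e [c, d]) [x, y] (b (F x y) (G x y))" for p x y
    by (intro rf_eval_Comp2)
  then show ?thesis unfolding total_computable2_def by blast
qed

lemma total_computable_id: "total_computable (\<lambda>p x. x)"
  unfolding total_computable_def by (rule exI[of _ "Proj 0"]) (auto intro: rf_eval_Proj)

lemma total_computable2_fst: "total_computable2 (\<lambda>x y. x)"
  unfolding total_computable2_def by (rule exI[of _ "Proj 0"]) (auto intro: rf_eval_Proj)

lemma total_computable2_snd: "total_computable2 (\<lambda>x y. y)"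
  unfolding total_computable2_def by (rule exI[of _ "Proj 1"]) (auto intro: rf_eval_Proj)

lemma total_computable_Suc:
  assumes "total_computable F" shows "total_computable (\<lambda>p x. Suc (F p x))"
proof -
  have "total_computable (\<lambda>p x. Suc x)"
    unfolding total_computable_def by (rule exI[of _ Succ]) (auto intro: rf_eval.succ)
  from total_computable_comp[OF this assms] show ?thesis .
qed

lemma total_computable2_Suc:
  assumes "total_computable2 F" shows "total_computable2 (\<lambda>x y. Suc (F x y))"
proof -
  have "total_computable2 (\<lambda>x y. Suc x)"
    unfolding total_computable2_def by (rule exI[of _ Succ]) (auto intro: rf_eval.succ)
  from total_computable2_comp2[OF this assms assms] show ?thesis .
qed

lemma total_computable_const: "total_computable (\<lambda>p x. n)"
proof (induction n)
  case 0
  then show ?case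
    unfolding total_computable_def by (rule exI[of _ Zero]) (auto intro: rf_eval.zero)
next
  case (Suc n)
  then show ?case by (rule total_computable_Suc)
qed

lemma total_computable_oracle:
  assumes "total_computable F" shows "total_computable (\<lambda>p x. p (F p x))"
proof -
  have "total_computable (\<lambda>p x. p x)"
    unfolding total_computable_def by (rule exI[of _ Orc]) (auto intro: rf_eval.orc)
  from total_computable_comp[OF this assms] show ?thesis .
qed

lemma total_computable2_Prec:
  assumes "\<And>y. b 0 y = f y" "\<And>n y. b (Suc n) y = h (b n y) n y"
    and "\<exists>c. \<forall>p y. rf_eval p c [y] (f y)" "\<exists>c. \<forall>p r n y. rf_eval p c [r, n, y] (h r n y)"
  shows "total_computable2 b"
proof -
  obtain cf ch where cf: "\<And>p y. rf_eval p cf [y] (f y)"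
    and ch: "\<And>p r n y. rf_eval p ch [r, n, y] (h r n y)"
    using assms(3,4) by blast
  have "rec_nat (f y) (\<lambda>n r. h r n y) n = b n y" for n y
    by (induction n) (simp_all add: assms)
  with rf_eval_Prec[OF cf ch] have "rf_eval p (Prec cf ch) [n, y] (b n y)" for p n y
    by metis
  then show ?thesis unfolding total_computable2_def by blast
qed

section \<open>Arithmetic and the pairing function\<close>

lemma total_computable2_add: "total_computable2 (+)"
proof (rule total_computable2_Prec[where f = "\<lambda>y. y" and h = "\<lambda>r n y. Suc r"])
  show "\<exists>c. \<forall>p y. rf_eval p c [y] y" by (rule exI[of _ "Proj 0"]) (auto intro: rf_eval_Proj)
  show "\<exists>c. \<forall>p r n y. rf_eval p c [r, n, y] (Suc r)"
    by (rule exI[of _ Succ]) (auto intro: rf_eval.succ)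
qed auto

lemma total_computable2_mult: "total_computable2 (*)"
proof (rule total_computable2_Prec[where f = "\<lambda>y. 0" and h = "\<lambda>r n y. y + r"])
  show "\<exists>c. \<forall>p y. rf_eval p c [y] 0" by (rule exI[of _ Zero]) (auto intro: rf_eval.zero)
  obtain c where c: "\<And>p x y. rf_eval p c [x, y] (x + y)"
    using total_computable2_add unfolding total_computable2_def by auto
  show "\<exists>c. \<forall>p r n y. rf_eval p c [r, n, y] (y + r)"
    by (rule exI[of _ "Comp c [Proj 2, Proj 0]"]) (auto intro!: rf_eval_Comp2 c rf_eval_Proj)
qed auto

lemma total_computable_pred:
  assumes "total_computable F" shows "total_computable (\<lambda>p x. F p x - 1)"
proof -
  have eq: "rec_nat 0 (\<lambda>n r. n) x = x - 1" for x :: nat by (cases x) auto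
  have "rf_eval p (Comp (Prec Zero (Proj 1)) [Proj 0, Proj 0]) [x] (x - 1)" for p x
    \<comment> \<open>The predecessor is the recursion that discards the previous value and returns
      its counter.\<close>
    unfolding eq[symmetric]
    by (rule rf_eval_Comp2[of _ _ _ x _ x])
      (auto intro!: rf_eval_Proj rf_eval_Prec rf_eval.zero)
  then have "total_computable (\<lambda>p x. x - 1)" unfolding total_computable_def by blast
  from total_computable_comp[OF this assms] show ?thesis .
qed

lemma total_computable2_diff: "total_computable2 (-)"
proof -
  obtain c where c: "\<And>p x. rf_eval p c [x] (x - 1)"
    using total_computable_pred[OF total_computable_id] unfolding total_computable_def by auto
  \<comment> \<open>\<open>Prec\<close> recurses on the first argument, which must be the
    subtrahend; the arguments are swapped back at the end.\<close>
  have "total_computable2 (\<lambda>n y. y - n)"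
  proof (rule total_computable2_Prec[where f = "\<lambda>y. y" and h = "\<lambda>r n y. r - 1"])
    show "\<exists>c. \<forall>p y. rf_eval p c [y] y" by (rule exI[of _ "Proj 0"]) (auto intro: rf_eval_Proj)
    show "\<exists>c. \<forall>p r n y. rf_eval p c [r, n, y] (r - 1)"
      by (rule exI[of _ "Comp c [Proj 0]"]) (auto intro!: rf_eval_Comp1 c[simplified] rf_eval_Proj)
  qed auto
  from total_computable2_comp2[OF this total_computable2_snd total_computable2_fst]
  show ?thesis .
qed

lemma total_computable2_triangle: "total_computable2 (\<lambda>x y. triangle x)"
proof (rule total_computable2_Prec[where f = "\<lambda>y. 0" and h = "\<lambda>r n y. r + Suc n"])
  show "\<exists>c. \<forall>p y. rf_eval p c [y] 0" by (rule exI[of _ Zero]) (auto intro: rf_eval.zero)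
  obtain c where c: "\<And>p x y. rf_eval p c [x, y] (x + y)"
    using total_computable2_add unfolding total_computable2_def by auto
  show "\<exists>c. \<forall>p r n y. rf_eval p c [r, n, y] (r + Suc n)"
    by (intro exI[of _ "Comp c [Proj 0, Comp Succ [Proj 1]]"] allI
        rf_eval_Comp2[OF rf_eval_Proj rf_eval_Comp1[OF rf_eval_Proj rf_eval.succ] c]) auto
qed auto

lemma total_computable2_prod_encode: "total_computable2 (\<lambda>x y. prod_encode (x, y))"
  unfolding prod_encode_def prod.case
  by (intro total_computable2_comp2[OF total_computable2_add]
      total_computable2_comp2[OF total_computable2_triangle _ total_computable2_fst]
      total_computable2_comp2[OF total_computable2_add] total_computable2_fst
      total_computable2_snd)

lemmas total_computable_add = total_computable_comp2[OF total_computable2_add]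
lemmas total_computable_mult = total_computable_comp2[OF total_computable2_mult]
lemmas total_computable_diff = total_computable_comp2[OF total_computable2_diff]
lemmas total_computable_prod_encode = total_computable_comp2[OF total_computable2_prod_encode]

lemma total_computable_triangle:
  assumes "total_computable F" shows "total_computable (\<lambda>p x. triangle (F p x))"
  using total_computable_comp2[OF total_computable2_triangle assms assms] .

definition pfst :: "nat \<Rightarrow> nat" where "pfst x = fst (prod_decode x)"
definition psnd :: "nat \<Rightarrow> nat" where "psnd x = snd (prod_decode x)"

lemma pfst_prod_encode [simp]: "pfst (prod_encode (x, y)) = x"
  and psnd_prod_encode [simp]: "psnd (prod_encode (x, y)) = y"
  by (simp_all add: pfst_def psnd_def)

text \<open>The diagonal \<open>pfst z + psnd z\<close> is the least \<open>s\<close> with \<open>z < triangle (Suc s)\<close>, which a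
  search finds.\<close>

lemma total_computable_diagonal: "total_computable (\<lambda>p z. pfst z + psnd z)"
proof -
  have "total_computable2 (\<lambda>s z. Suc z - triangle (Suc s))"
    by (intro total_computable2_comp2[OF total_computable2_diff]
        total_computable2_comp2[OF total_computable2_triangle _ total_computable2_fst]
        total_computable2_Suc
        total_computable2_fst total_computable2_snd)
  then obtain c where c: "\<And>p s z. rf_eval p c [s, z] (Suc z - triangle (Suc s))"
    unfolding total_computable2_def by blast
  have "rf_eval p (Mu c) [z] (pfst z + psnd z)" for p z
  proof (rule rf_eval.mu)
    have z: "z = triangle (pfst z + psnd z) + pfst z"
      using prod_decode_inverse[of z]
      by (cases "prod_decode z") (simp add: prod_encode_def pfst_def psnd_def)
    have "Suc z - triangle (Suc (pfst z + psnd z)) = 0"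
      by (subst z) simp
    then show "rf_eval p c [pfst z + psnd z, z] 0"
      using c[of p "pfst z + psnd z" z] by simp
    show "\<forall>i<pfst z + psnd z. \<exists>v>0. rf_eval p c [i, z] v"
    proof (intro allI impI)
      fix i assume i: "i < pfst z + psnd z"
      have "mono triangle" by (rule mono_iff_le_Suc[THEN iffD2]) simp
      from monoD[OF this Suc_leI[OF i]] have "triangle (Suc i) \<le> z"
        by (subst z) simp
      then have "0 < Suc z - triangle (Suc i)" by simp
      with c[of p i z] show "\<exists>v>0. rf_eval p c [i, z] v" by blast
    qed
  qed
  then show ?thesis unfolding total_computable_def by blast
qed

lemma total_computable_pfst:
  assumes "total_computable F" shows "total_computable (\<lambda>p x. pfst (F p x))"
proof -
  have eq: "z - triangle (pfst z + psnd z) = pfst z" for z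
    using prod_decode_inverse[of z]
    by (cases "prod_decode z") (simp add: prod_encode_def pfst_def psnd_def)
  have "total_computable (\<lambda>p z. z - triangle (pfst z + psnd z))"
    by (intro total_computable_diff total_computable_triangle total_computable_id
        total_computable_diagonal)
  then have "total_computable (\<lambda>p z. pfst z)" unfolding eq .
  from total_computable_comp[OF this assms] show ?thesis .
qed

lemma total_computable_psnd:
  assumes "total_computable F" shows "total_computable (\<lambda>p x. psnd (F p x))"
proof -
  have "total_computable (\<lambda>p z. (pfst z + psnd z) - pfst z)"
    by (intro total_computable_diff total_computable_pfst total_computable_id
        total_computable_diagonal)
  then have "total_computable (\<lambda>p z. psnd z)" by simp
  from total_computable_comp[OF this assms] show ?thesis .
qed

text \<open>In the last premise \<open>z\<close> codes a triple: previous value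
  \<open>pfst z\<close>, counter \<open>pfst (psnd z)\<close> and parameter
  \<open>psnd (psnd z)\<close>, in the order in which \<open>Prec\<close> passes them. This is the
  recursion principle for unary functions.\<close>

lemma total_computable_rec_nat:
  assumes "total_computable A" "total_computable N"
    and "total_computable (\<lambda>p z. G p (psnd (psnd z)) (pfst (psnd z)) (pfst z))"
  shows "total_computable (\<lambda>p x. rec_nat (A p x) (G p x) (N p x))"
proof -
  obtain cA cN cG where cA: "\<And>p x. rf_eval p cA [x] (A p x)"
    and cN: "\<And>p x. rf_eval p cN [x] (N p x)"
    and cG: "\<And>p z. rf_eval p cG [z] (G p (psnd (psnd z)) (pfst (psnd z)) (pfst z))"
    using assms unfolding total_computable_def by blast
  obtain e where e: "\<And>p x y. rf_eval p e [x, y] (prod_encode (x, y))"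
    using total_computable2_prod_encode unfolding total_computable2_def by auto
  define h where "h = Comp cG [Comp e [Proj 0, Comp e [Proj 1, Proj 2]]]"
  have h: "rf_eval p h [y, n, x] (G p x n y)" for p x n y
    unfolding h_def
  proof (rule rf_eval_Comp1)
    show "rf_eval p (Comp e [Proj 0, Comp e [Proj 1, Proj 2]]) [y, n, x]
        (prod_encode (y, prod_encode (n, x)))"
      by (rule rf_eval_Comp2[OF rf_eval_Proj rf_eval_Comp2[OF rf_eval_Proj rf_eval_Proj e] e]) auto
    show "rf_eval p cG [prod_encode (y, prod_encode (n, x))] (G p x n y)"
      using cG[of p "prod_encode (y, prod_encode (n, x))"] by simp
  qed
  have "rf_eval p (Comp (Prec cA h) [cN, Proj 0]) [x] (rec_nat (A p x) (G p x) (N p x))" for p x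
    by (rule rf_eval_Comp2[OF cN rf_eval_Proj rf_eval_Prec]) (auto intro: cA h)
  then show ?thesis unfolding total_computable_def by blast
qed

text \<open>A recursion over \<open>N p x\<close> whose step forgets the previous value returns
  \<open>B p x\<close> after any positive number of rounds. \<open>A\<close> is evaluated in both
  cases, which is harmless because it is total.\<close>

lemma total_computable_if_zero:
  assumes "total_computable N" "total_computable A" "total_computable B"
  shows "total_computable (\<lambda>p x. if N p x = 0 then A p x else B p x)"
proof -
  have eq: "(if N p x = 0 then A p x else B p x) = rec_nat (A p x) (\<lambda>n r. B p x) (N p x)" for p x
    by (cases "N p x") auto
  show ?thesis unfolding eq
    by (intro total_computable_rec_nat assms total_computable_comp[OF assms(3)]
        total_computable_psnd total_computable_id)
qed

section \<open>Decidability, coded lists and rational arithmetic\<close>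

definition decidable :: "((nat \<Rightarrow> nat) \<Rightarrow> nat \<Rightarrow> bool) \<Rightarrow> bool" where
  "decidable P \<longleftrightarrow> total_computable (\<lambda>p x. of_bool (P p x))"

lemma total_computable_if:
  assumes "decidable P" "total_computable A" "total_computable B"
  shows "total_computable (\<lambda>p x. if P p x then A p x else B p x)"
proof -
  have "total_computable (\<lambda>p x. if of_bool (P p x) = (0::nat) then B p x else A p x)"
    by (intro total_computable_if_zero assms assms(1)[unfolded decidable_def])
  moreover have "(\<lambda>p x. if of_bool (P p x) = (0::nat) then B p x else A p x) =
      (\<lambda>p x. if P p x then A p x else B p x)"
    by (intro ext) simp
  ultimately show ?thesis by simp
qed

lemma decidable_le:
  assumes "total_computable F" "total_computable G"
  shows "decidable (\<lambda>p x. F p x \<le> G p x)"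
proof -
  have "total_computable (\<lambda>p x. if F p x - G p x = 0 then 1 else 0)"
    by (intro total_computable_if_zero total_computable_diff assms total_computable_const)
  then show ?thesis by (simp add: decidable_def of_bool_def)
qed

lemma decidable_less:
  assumes "total_computable F" "total_computable G"
  shows "decidable (\<lambda>p x. F p x < G p x)"
  using decidable_le[OF total_computable_Suc[OF assms(1)] assms(2)] by (simp add: Suc_le_eq)

lemma decidable_conj:
  assumes "decidable P" "decidable Q" shows "decidable (\<lambda>p x. P p x \<and> Q p x)"
  using total_computable_mult[of "\<lambda>p x. of_bool (P p x)" "\<lambda>p x. of_bool (Q p x)"] assms
  unfolding decidable_def of_bool_conj by blast

lemma prod_decode_0 [simp]: "prod_decode 0 = (0, 0)"
  using prod_encode_inverse[of "(0, 0)"] by (simp add: prod_encode_def)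

lemma total_computable_nth0:
  assumes "total_computable F" shows "total_computable (\<lambda>p x. nth0 (list_decode (F p x)) i)"
  using assms
proof (induction i arbitrary: F)
  case 0
  \<comment> \<open>A nonempty list has code \<open>Suc\<close> of the pair of its head and tail
    code. For \<open>n = 0\<close> the truncated predecessor decodes to \<open>(0, 0)\<close>, which
    gives the default \<open>0\<close> of \<open>nth0\<close>.\<close>
  have eq: "nth0 (list_decode n) 0 = pfst (n - 1)" for n
    by (cases n) (simp_all add: nth0_def pfst_def split: prod.split)
  show ?case unfolding eq by (intro total_computable_pfst total_computable_pred 0)
next
  case (Suc i)
  have eq: "nth0 (list_decode n) (Suc i) = nth0 (list_decode (psnd (n - 1))) i" for n
    by (cases n) (simp_all add: nth0_def psnd_def split: prod.split)
  show ?case unfolding eq by (intro Suc total_computable_psnd total_computable_pred)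
qed

lemma total_computable_two_power:
  assumes "total_computable F" shows "total_computable (\<lambda>p x. 2 ^ F p x)"
proof -
  have eq: "2 ^ n = rec_nat (1::nat) (\<lambda>n r. r + r) n" for n :: nat
    by (induction n) auto
  show ?thesis unfolding eq
    by (intro total_computable_rec_nat assms total_computable_const total_computable_add
        total_computable_pfst total_computable_id)
qed

lemma total_computable_mod_two:
  assumes "total_computable F" shows "total_computable (\<lambda>p x. F p x mod 2)"
proof -
  have eq: "n mod 2 = rec_nat 0 (\<lambda>n r. 1 - r) n" for n :: nat
    by (induction n) (auto simp: mod_Suc)
  show ?thesis unfolding eq
    by (intro total_computable_rec_nat assms total_computable_const total_computable_diff
        total_computable_pfst total_computable_id)
qed

lemma total_computable_div_two:
  assumes "total_computable F" shows "total_computable (\<lambda>p x. F p x div 2)"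
proof -
  have eq: "n div 2 = rec_nat 0 (\<lambda>n r. r + n mod 2) n" for n :: nat
    by (induction n) (auto simp: div_Suc, presburger+)
  show ?thesis unfolding eq
    by (intro total_computable_rec_nat assms total_computable_const total_computable_add
        total_computable_mod_two total_computable_psnd total_computable_pfst total_computable_id)
qed

text \<open>A difference of naturals as numerator avoids signs, and a successor as denominator
  avoids division by zero. Fractions need not be reduced, so field operations and comparisons become
  arithmetic on naturals.\<close>

definition rat_computable :: "((nat \<Rightarrow> nat) \<Rightarrow> nat \<Rightarrow> real) \<Rightarrow> bool" where
  "rat_computable h \<longleftrightarrow> (\<exists>a b c. total_computable a \<and> total_computable b \<and> total_computable c \<and>
     (\<forall>p x. h p x = (real (a p x) - real (b p x)) / real (Suc (c p x))))"

lemma rat_computableI: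
  assumes "total_computable a" "total_computable b" "total_computable c"
    and "\<And>p x. h p x = (real (a p x) - real (b p x)) / real (Suc (c p x))"
  shows "rat_computable h"
  using assms unfolding rat_computable_def by blast

lemma rat_computable_of_nat:
  assumes "total_computable F" shows "rat_computable (\<lambda>p x. real (F p x))"
  by (rule rat_computableI[OF assms total_computable_const[of 0] total_computable_const[of 0]]) simp

lemma rat_computable_half_power:
  assumes "total_computable F" shows "rat_computable (\<lambda>p x. (1/2) ^ F p x)"
  by (rule rat_computableI[OF total_computable_const[of 1] total_computable_const[of 0]
        total_computable_pred[OF total_computable_two_power[OF assms]]])
    (simp add: of_nat_diff power_one_over)

lemma rat_computable_minus:
  assumes "rat_computable h" shows "rat_computable (\<lambda>p x. - h p x)"
proof -
  obtain a b c where "total_computable a" "total_computable b" "total_computable c"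
    and h: "\<And>p x. h p x = (real (a p x) - real (b p x)) / real (Suc (c p x))"
    using assms unfolding rat_computable_def by blast
  then show ?thesis by (intro rat_computableI[of b a c]) (auto simp: h field_simps)
qed

lemma rat_computable_add:
  assumes "rat_computable h" "rat_computable k" shows "rat_computable (\<lambda>p x. h p x + k p x)"
proof -
  obtain a b c where abc: "total_computable a" "total_computable b" "total_computable c"
    and h: "\<And>p x. h p x = (real (a p x) - real (b p x)) / real (Suc (c p x))"
    using assms(1) unfolding rat_computable_def by blast
  obtain a' b' c' where abc': "total_computable a'" "total_computable b'" "total_computable c'"
    and k: "\<And>p x. k p x = (real (a' p x) - real (b' p x)) / real (Suc (c' p x))"
    using assms(2) unfolding rat_computable_def by blast
  show ?thesis
  proof (rule rat_computableI)
    show "total_computable (\<lambda>p x. a p x * Suc (c' p x) + a' p x * Suc (c p x))"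
      "total_computable (\<lambda>p x. b p x * Suc (c' p x) + b' p x * Suc (c p x))"
      "total_computable (\<lambda>p x. Suc (c p x) * Suc (c' p x) - 1)"
      by (intro total_computable_add total_computable_mult total_computable_Suc
          total_computable_pred abc abc')+
    have alg: "(a - b) / c + (a' - b') / c' = ((a * c' + a' * c) - (b * c' + b' * c)) / (c * c')"
      if "c > 0" "c' > 0" for a b c a' b' c' :: real
      using that by (simp add: field_simps)
    \<comment> \<open>The stored number is the denominator minus one; truncated subtraction is exact
      for a positive product.\<close>
    have eq: "real (Suc (m * n - 1)) = real m * real n" if "m > 0" "n > 0" for m n
      using that by (metis Suc_diff_1 nat_0_less_mult_iff of_nat_mult)
    show "h p x + k p x = (real (a p x * Suc (c' p x) + a' p x * Suc (c p x))
        - real (b p x * Suc (c' p x) + b' p x * Suc (c p x))) /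
        real (Suc (Suc (c p x) * Suc (c' p x) - 1))" for p x
      unfolding h k eq[OF zero_less_Suc zero_less_Suc] of_nat_add of_nat_mult
      by (rule alg) auto
  qed
qed

lemma rat_computable_mult:
  assumes "rat_computable h" "rat_computable k" shows "rat_computable (\<lambda>p x. h p x * k p x)"
proof -
  obtain a b c where abc: "total_computable a" "total_computable b" "total_computable c"
    and h: "\<And>p x. h p x = (real (a p x) - real (b p x)) / real (Suc (c p x))"
    using assms(1) unfolding rat_computable_def by blast
  obtain a' b' c' where abc': "total_computable a'" "total_computable b'" "total_computable c'"
    and k: "\<And>p x. k p x = (real (a' p x) - real (b' p x)) / real (Suc (c' p x))"
    using assms(2) unfolding rat_computable_def by blast
  show ?thesis
  proof (rule rat_computableI)
    show "total_computable (\<lambda>p x. a p x * a' p x + b p x * b' p x)"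
      "total_computable (\<lambda>p x. a p x * b' p x + b p x * a' p x)"
      "total_computable (\<lambda>p x. Suc (c p x) * Suc (c' p x) - 1)"
      by (intro total_computable_add total_computable_mult total_computable_Suc
          total_computable_pred abc abc')+
    have alg: "(a - b) / c * ((a' - b') / c') = ((a * a' + b * b') - (a * b' + b * a')) / (c * c')"
      for a b c a' b' c' :: real
      by (simp add: algebra_simps)
    have eq: "real (Suc (m * n - 1)) = real m * real n" if "m > 0" "n > 0" for m n
      using that by (metis Suc_diff_1 nat_0_less_mult_iff of_nat_mult)
    show "h p x * k p x = (real (a p x * a' p x + b p x * b' p x)
        - real (a p x * b' p x + b p x * a' p x)) /
        real (Suc (Suc (c p x) * Suc (c' p x) - 1))" for p x
      unfolding h k eq[OF zero_less_Suc zero_less_Suc] of_nat_add of_nat_mult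
      by (rule alg)
  qed
qed

lemma rat_computable_diff:
  assumes "rat_computable h" "rat_computable k" shows "rat_computable (\<lambda>p x. h p x - k p x)"
  using rat_computable_add[OF assms(1) rat_computable_minus[OF assms(2)]] by simp

lemma rat_computable_power2:
  "rat_computable h \<Longrightarrow> rat_computable (\<lambda>p x. (h p x)\<^sup>2)"
  unfolding power2_eq_square by (rule rat_computable_mult)

lemma rat_computable_sum:
  assumes "\<And>i. i \<in> I \<Longrightarrow> rat_computable (h i)" shows "rat_computable (\<lambda>p x. \<Sum>i\<in>I. h i p x)"
  using assms
proof (induction I rule: infinite_finite_induct)
  case (insert i I)
  then show ?case by (simp add: rat_computable_add)
qed (use rat_computable_of_nat[OF total_computable_const[of 0]] in simp_all)

lemma rat_computable_rat_dec:
  assumes "total_computable F" shows "rat_computable (\<lambda>p x. rat_dec (F p x))"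
proof -
  \<comment> \<open>Even \<open>n\<close> codes \<open>n div 2\<close> and odd \<open>n\<close>
    codes \<open>- (n div 2) - 1\<close>; the parity factors switch off the wrong summand.\<close>
  have int_decode: "of_int (int_decode n) =
      real ((1 - n mod 2) * (n div 2)) - real ((n mod 2) * Suc (n div 2))" for n
    by (auto simp: int_decode_def sum_decode_def mod_2_eq_odd)
  show ?thesis
  proof (rule rat_computableI)
    show "total_computable (\<lambda>p x. (1 - pfst (F p x) mod 2) * (pfst (F p x) div 2))"
      "total_computable (\<lambda>p x. (pfst (F p x) mod 2) * Suc (pfst (F p x) div 2))"
      "total_computable (\<lambda>p x. psnd (F p x))"
      by (intro total_computable_mult total_computable_diff total_computable_const
          total_computable_mod_two total_computable_div_two total_computable_Suc
          total_computable_pfst total_computable_psnd assms)+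
    show "rat_dec (F p x) = (real ((1 - pfst (F p x) mod 2) * (pfst (F p x) div 2))
        - real ((pfst (F p x) mod 2) * Suc (pfst (F p x) div 2))) / real (Suc (psnd (F p x)))" for p x
      unfolding rat_dec_def int_decode[symmetric] pfst_def psnd_def by (simp split: prod.split)
  qed
qed

lemma decidable_rat_le:
  assumes "rat_computable h" "rat_computable k" shows "decidable (\<lambda>p x. h p x \<le> k p x)"
proof -
  have "rat_computable (\<lambda>p x. k p x - h p x)" using assms by (intro rat_computable_diff)
  then obtain a b c where abc: "total_computable a" "total_computable b"
    and eq: "\<And>p x. k p x - h p x = (real (a p x) - real (b p x)) / real (Suc (c p x))"
    unfolding rat_computable_def by blast
  have "h p x \<le> k p x \<longleftrightarrow> 0 \<le> k p x - h p x" for p x by simp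
  also have "\<dots> p x \<longleftrightarrow> b p x \<le> a p x" for p x
    unfolding eq by (simp add: zero_le_divide_iff)
  finally show ?thesis using decidable_le[OF abc(2,1)] by simp
qed

lemma decidable_rat_less:
  assumes "rat_computable h" "rat_computable k" shows "decidable (\<lambda>p x. h p x < k p x)"
proof -
  have "rat_computable (\<lambda>p x. k p x - h p x)" using assms by (intro rat_computable_diff)
  then obtain a b c where abc: "total_computable a" "total_computable b"
    and eq: "\<And>p x. k p x - h p x = (real (a p x) - real (b p x)) / real (Suc (c p x))"
    unfolding rat_computable_def by blast
  have "h p x < k p x \<longleftrightarrow> 0 < k p x - h p x" for p x by simp
  also have "\<dots> p x \<longleftrightarrow> b p x < a p x" for p x
    unfolding eq by (simp add: zero_less_divide_iff)
  finally show ?thesis using decidable_less[OF abc(2,1)] by simp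
qed

section \<open>Evaluation with bounded oracle use\<close>

text \<open>\<open>bounded_eval N e c l\<close> runs \<open>c\<close> on the coded argument list \<open>l\<close> with the constant oracle
  \<open>e\<close>, giving up (result \<open>0\<close>, whereas \<open>Suc v\<close> stands for the value \<open>v\<close>) as soon as the oracle is
  queried at a position \<open>\<ge> N\<close> or an unbounded search exceeds \<open>N\<close>.  A value it returns is
  thus the value for every oracle that starts with \<open>N\<close> copies of \<open>e\<close>.\<close>

definition bounded_search :: "(nat \<Rightarrow> nat) \<Rightarrow> nat \<Rightarrow> nat" where
  "bounded_search h N =
    rec_nat 0 (\<lambda>n r. if r = 0 then if h n = 0 then 1 else if h n - 1 = 0 then n + 2 else 0 else r) N - 1"

fun bounded_eval :: "nat \<Rightarrow> nat \<Rightarrow> rf \<Rightarrow> nat \<Rightarrow> nat"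
  and bounded_evals :: "nat \<Rightarrow> nat \<Rightarrow> rf list \<Rightarrow> nat \<Rightarrow> nat" where
  "bounded_eval N e Zero l = 1"
| "bounded_eval N e Succ l = Suc (Suc (pfst (l - 1)))"
| "bounded_eval N e (Proj i) l = Suc (nth0 (list_decode l) i)"
| "bounded_eval N e Orc l = (if pfst (l - 1) < N then Suc e else 0)"
| "bounded_eval N e (Comp f gs) l =
    (if bounded_evals N e gs l = 0 then 0 else bounded_eval N e f (bounded_evals N e gs l - 1))"
| "bounded_eval N e (Prec f g) l =
    rec_nat (bounded_eval N e f (psnd (l - 1)))
      (\<lambda>n r. if r = 0 then 0 else bounded_eval N e g
        (Suc (prod_encode (r - 1, Suc (prod_encode (n, psnd (l - 1)))))))
      (pfst (l - 1))"
| "bounded_eval N e (Mu f) l =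
    bounded_search (\<lambda>n. bounded_eval N e f (Suc (prod_encode (n, l)))) N"
| "bounded_evals N e [] l = 1"
| "bounded_evals N e (g # gs) l =
    (if bounded_eval N e g l = 0 then 0 else if bounded_evals N e gs l = 0 then 0
     else Suc (Suc (prod_encode (bounded_eval N e g l - 1, bounded_evals N e gs l - 1))))"

text \<open>Here \<open>y\<close> is the true least zero and \<open>h\<close> may give up at any
  argument. The search then gives up too, but it cannot report a wrong position.\<close>

lemma bounded_search_consistent:
  assumes "\<And>i. i < y \<Longrightarrow> h i \<noteq> 1" "h y = 0 \<or> h y = 1"
  shows "bounded_search h N = 0 \<or> bounded_search h N = Suc y"
proof -
  \<comment> \<open>The states are \<open>0\<close> for still searching, \<open>1\<close> for
    aborted at an undefined value, and \<open>m + 2\<close> for a zero found at \<open>m\<close>.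
    The final \<open>- 1\<close> turns the first two into failure and the third into
    \<open>Suc m\<close>.\<close>
  define r where "r = rec_nat 0 (\<lambda>n r. if r = 0 then if h n = 0 then 1 else
    if h n - 1 = 0 then n + 2 else 0 else r)"
  have "(n \<le> y \<longrightarrow> r n = 0 \<or> r n = 1) \<and> (n > y \<longrightarrow> r n = 1 \<or> r n = y + 2)" for n
  proof (induction n)
    case (Suc n)
    have rS: "r (Suc n) = (if r n = 0 then if h n = 0 then 1 else
        if h n - 1 = 0 then n + 2 else 0 else r n)"
      by (simp add: r_def)
    consider "n < y" | "n = y" | "n > y" by linarith
    then show ?case
    proof cases
      case 1
      with Suc assms(1)[OF 1] show ?thesis by (auto simp: rS)
    next
      case 2
      with Suc assms(2) rS show ?thesis by auto
    next
      case 3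
      with Suc show ?thesis by (auto simp: rS)
    qed
  qed (simp add: r_def)
  from this[of N] have "r N - 1 = 0 \<or> r N - 1 = Suc y" by (cases "N \<le> y") auto
  then show ?thesis by (simp add: bounded_search_def r_def)
qed

lemma bounded_search_complete:
  assumes "\<And>i. i < y \<Longrightarrow> h i > 1" "h y = 1" "y < N"
  shows "bounded_search h N = Suc y"
proof -
  define r where "r = rec_nat 0 (\<lambda>n r. if r = 0 then if h n = 0 then 1 else
    if h n - 1 = 0 then n + 2 else 0 else r)"
  have "(n \<le> y \<longrightarrow> r n = 0) \<and> (n > y \<longrightarrow> r n = y + 2)" for n
  proof (induction n)
    case (Suc n)
    have rS: "r (Suc n) = (if r n = 0 then if h n = 0 then 1 else
        if h n - 1 = 0 then n + 2 else 0 else r n)"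
      by (simp add: r_def)
    consider "n < y" | "n = y" | "n > y" by linarith
    then show ?case
    proof cases
      case 1
      with Suc assms(1)[OF 1] show ?thesis by (auto simp: rS)
    next
      case 2
      with Suc assms(2) rS show ?thesis by auto
    next
      case 3
      with Suc show ?thesis by (auto simp: rS)
    qed
  qed (simp add: r_def)
  from this[of N] have "r N - 1 = Suc y" using assms(3) by simp
  then show ?thesis by (simp add: bounded_search_def r_def)
qed

text \<open>The definition uses \<open>rec_nat\<close>, which suits the proof of computability;
  these equations have the shape of the rules \<open>prec0\<close> and \<open>precS\<close> and suit
  induction over \<open>rf_eval\<close>.\<close>

lemma bounded_eval_Prec:
  "bounded_eval N e (Prec f g) (list_encode (0 # xs)) = bounded_eval N e f (list_encode xs)"
  "bounded_eval N e (Prec f g) (list_encode (Suc n # xs)) =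
    (let r = bounded_eval N e (Prec f g) (list_encode (n # xs)) in
     if r = 0 then 0 else bounded_eval N e g (list_encode ((r - 1) # n # xs)))"
proof -
  have code: "pfst (list_encode (n # xs) - 1) = n" "psnd (list_encode (n # xs) - 1) = list_encode xs"
    for n by simp_all
  show "bounded_eval N e (Prec f g) (list_encode (0 # xs)) = bounded_eval N e f (list_encode xs)"
    "bounded_eval N e (Prec f g) (list_encode (Suc n # xs)) =
      (let r = bounded_eval N e (Prec f g) (list_encode (n # xs)) in
       if r = 0 then 0 else bounded_eval N e g (list_encode ((r - 1) # n # xs)))"
    unfolding bounded_eval.simps code by (simp_all add: Let_def)
qed

lemma bounded_evals_consistent:
  assumes "list_all2 (\<lambda>g y. bounded_eval N e g l = 0 \<or> bounded_eval N e g l = Suc y) gs ys"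
  shows "bounded_evals N e gs l = 0 \<or> bounded_evals N e gs l = Suc (list_encode ys)"
  using assms by (induction rule: list_all2_induct) auto

lemma bounded_eval_consistent:
  assumes "rf_eval p c xs y" "\<And>i. i < N \<Longrightarrow> p i = e"
  shows "bounded_eval N e c (list_encode xs) = 0 \<or> bounded_eval N e c (list_encode xs) = Suc y"
  using assms(1)
proof (induction rule: rf_eval.induct)
  case (proj i xs)
  then show ?case by (simp add: nth0_def)
next
  case (comp xs gs ys f z)
  have "bounded_evals N e gs (list_encode xs) = 0 \<or>
      bounded_evals N e gs (list_encode xs) = Suc (list_encode ys)"
    by (rule bounded_evals_consistent, rule list_all2_mono[OF comp.IH(1)]) auto
  with comp.IH(2) show ?case by auto
next
  case (prec0 f xs y g)
  then show ?case by (simp only: bounded_eval_Prec)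
next
  case (precS f g n xs y z)
  then show ?case unfolding bounded_eval_Prec by (auto simp: Let_def simp del: bounded_eval.simps)
next
  case (mu f y xs)
  \<comment> \<open>Below \<open>y\<close> the true value \<open>v\<close> is positive, so the
    result is \<open>0\<close> or \<open>Suc v > 1\<close>, never \<open>1\<close>, the code of the
    value zero.\<close>
  have "bounded_eval N e f (Suc (prod_encode (i, list_encode xs))) \<noteq> 1" if "i < y" for i
    using mu.IH(2) that by fastforce
  then show ?case
    unfolding bounded_eval.simps using mu.IH(1) by (intro bounded_search_consistent) auto
qed (auto simp: assms(2))

lemma eventually_bounded_evals:
  assumes "list_all2 (\<lambda>g y. \<forall>\<^sub>F N in sequentially. bounded_eval N e g l = Suc y) gs ys"
  shows "\<forall>\<^sub>F N in sequentially. bounded_evals N e gs l = Suc (list_encode ys)"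
  using assms
proof (induction rule: list_all2_induct)
  case (Cons g gs y ys)
  from Cons(1,3) show ?case by eventually_elim simp
qed simp

text \<open>A terminating computation makes finitely many queries and finite searches. Every step of
  the derivation contributes a threshold for \<open>N\<close>, and finitely many thresholds can be
  met at once.\<close>

lemma eventually_bounded_eval:
  assumes "rf_eval (\<lambda>_. e) c xs y"
  shows "\<forall>\<^sub>F N in sequentially. bounded_eval N e c (list_encode xs) = Suc y"
  using assms
proof (induction rule: rf_eval.induct)
  case (proj i xs)
  then show ?case by (simp add: nth0_def)
next
  case (orc x xs)
  show ?case using eventually_gt_at_top[of x] by eventually_elim simp
next
  case (comp xs gs ys f z)
  have "\<forall>\<^sub>F N in sequentially. bounded_evals N e gs (list_encode xs) = Suc (list_encode ys)"
    by (rule eventually_bounded_evals, rule list_all2_mono[OF comp.IH(1)]) auto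
  from this comp.IH(2) show ?case by eventually_elim simp
next
  case (prec0 f xs y g)
  then show ?case by (simp only: bounded_eval_Prec)
next
  case (precS f g n xs y z)
  from precS.IH show ?case by eventually_elim (simp only: bounded_eval_Prec, simp add: Let_def)
next
  case (mu f y xs)
  have "\<forall>\<^sub>F N in sequentially. \<forall>i\<in>{..<y}. bounded_eval N e f (Suc (prod_encode (i, list_encode xs))) > 1"
  proof (rule eventually_ball_finite)
    show "\<forall>i\<in>{..<y}. \<forall>\<^sub>F N in sequentially. bounded_eval N e f (Suc (prod_encode (i, list_encode xs))) > 1"
    proof
      fix i assume "i \<in> {..<y}"
      then obtain v where "v > 0"
        and "\<forall>\<^sub>F N in sequentially. bounded_eval N e f (list_encode (i # xs)) = Suc v"
        using mu.IH(2) by auto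
      from this(2) show "\<forall>\<^sub>F N in sequentially. bounded_eval N e f (Suc (prod_encode (i, list_encode xs))) > 1"
        by eventually_elim (use \<open>v > 0\<close> in simp)
    qed
  qed simp
  from this mu.IH(1) eventually_gt_at_top[of y] show ?case
    by eventually_elim (auto intro!: bounded_search_complete)
qed simp_all

lemma total_computable_bounded_evals:
  assumes "\<And>g. g \<in> set gs \<Longrightarrow> total_computable (\<lambda>p x. bounded_eval (N p x) (e p x) g (l p x))"
  shows "total_computable (\<lambda>p x. bounded_evals (N p x) (e p x) gs (l p x))"
  using assms
proof (induction gs)
  case (Cons g gs)
  then show ?case unfolding bounded_evals.simps
    by (intro total_computable_if_zero total_computable_const total_computable_Suc
        total_computable_prod_encode total_computable_pred) auto
qed (simp add: total_computable_const)

text \<open>The program \<open>c\<close> is fixed, so induction over its syntax replaces a universal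
  machine; only the bound, the oracle value and the argument list vary.\<close>

lemma total_computable_bounded_eval:
  assumes "total_computable N" "total_computable e" "total_computable l"
  shows "total_computable (\<lambda>p x. bounded_eval (N p x) (e p x) c (l p x))"
  using assms
proof (induction c arbitrary: N e l)
  case Zero
  then show ?case by (simp add: total_computable_const)
next
  case Succ
  then show ?case unfolding bounded_eval.simps
    by (intro total_computable_Suc total_computable_pfst total_computable_pred)
next
  case (Proj i)
  then show ?case unfolding bounded_eval.simps
    by (intro total_computable_Suc total_computable_nth0)
next
  case Orc
  then show ?case unfolding bounded_eval.simps
    by (intro total_computable_if decidable_less total_computable_Suc total_computable_pfst
        total_computable_pred total_computable_const)
next
  case (Comp f gs)
  have gs: "total_computable (\<lambda>p x. bounded_evals (N p x) (e p x) gs (l p x))"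
    by (intro total_computable_bounded_evals Comp)
  show ?case unfolding bounded_eval.simps
    by (intro total_computable_if_zero gs total_computable_const Comp.IH(1) Comp.prems
        total_computable_pred)
next
  case (Prec f g)
  \<comment> \<open>Inside the recursion the input is the last component of a coded triple, so
    \<open>N\<close>, \<open>e\<close> and \<open>l\<close> have to be composed with that
    projection.\<close>
  show ?case unfolding bounded_eval.simps
    by (intro total_computable_rec_nat total_computable_if_zero total_computable_const Prec.IH
        Prec.prems total_computable_comp[OF Prec.prems(1)] total_computable_comp[OF Prec.prems(2)]
        total_computable_comp[OF Prec.prems(3)] total_computable_pred total_computable_Suc
        total_computable_prod_encode total_computable_pfst total_computable_psnd total_computable_id)
next
  case (Mu f)
  show ?case unfolding bounded_eval.simps bounded_search_def
    by (intro total_computable_rec_nat total_computable_if_zero total_computable_const Mu.IH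
        Mu.prems total_computable_comp[OF Mu.prems(1)] total_computable_comp[OF Mu.prems(2)]
        total_computable_comp[OF Mu.prems(3)] total_computable_pred total_computable_Suc
        total_computable_add
        total_computable_prod_encode total_computable_pfst total_computable_psnd total_computable_id)
qed

section \<open>Points with surjective derivative\<close>

lemma linear_inj_on_if_dim_image_ge:
  fixes f :: "'a::euclidean_space \<Rightarrow> 'b::euclidean_space"
  assumes f: "linear f" and S: "subspace S" and le: "dim S \<le> dim (f ` S)"
  shows "inj_on f S"
proof -
  obtain B where B: "B \<subseteq> S" "independent B" "S \<subseteq> span B" "card B = dim S"
    by (rule basis_exists)
  have fin: "finite B" using B(2) by (rule independent_imp_finite)
  have SB: "S = span B" using B S by (metis span_minimal subset_antisym)
  have img: "f ` S = span (f ` B)" unfolding SB by (rule linear_span_image[OF f, symmetric])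
  have "card (f ` B) \<le> card B" using fin by (rule card_image_le)
  moreover have "dim (f ` S) \<le> card (f ` B)"
    unfolding img dim_span using dim_le_card'[OF finite_imageI[OF fin]] .
  ultimately have card: "card (f ` B) = card B" "dim (f ` S) = card (f ` B)"
    using le B(4) by auto
  have "inj_on f B" using eq_card_imp_inj_on[OF fin card(1)] .
  moreover have "independent (f ` B)"
    by (rule card_le_dim_spanning[of _ "f ` S"])
      (use B img fin card in \<open>auto intro: span_base\<close>)
  ultimately show ?thesis
    unfolding SB using linear_inj_on_span_iff_independent_image[OF f] by blast
qed

text \<open>The constant rank theorem in disguise: at a point \<open>x0\<close> of maximal rank, with \<open>P\<close> a
  generalized inverse of \<open>A = g' x0\<close>, the map \<open>\<phi> x = P (g x) + x - P (A x)\<close> is a local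
  diffeomorphism in whose coordinates \<open>g\<close> is constant along \<open>ker A\<close>. Hence \<open>A \<circ> P\<close> is
  injective on the image of a neighbourhood, which is open.\<close>

lemma surj_derivative_dense:
  fixes g :: "'a::euclidean_space \<Rightarrow> 'b::euclidean_space" and g' :: "'a \<Rightarrow> 'a \<Rightarrow> 'b"
  assumes g_open: "\<And>U. open U \<Longrightarrow> open (g ` U)"
    and g_deriv: "\<And>x. (g has_derivative g' x) (at x)"
    and g'_cont: "\<And>h. continuous_on UNIV (\<lambda>x. g' x h)"
    and V: "open V" "V \<noteq> {}"
  shows "\<exists>x\<in>V. surj (g' x)"
proof -
  have lin: "linear (g' x)" for x using g_deriv has_derivative_linear by blast
  obtain x0 where x0: "x0 \<in> V" and max: "\<And>x. x \<in> V \<Longrightarrow> dim (range (g' x)) \<le> dim (range (g' x0))"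
  proof -
    obtain v where "v \<in> V" using V by blast
    have "\<exists>x. x \<in> V \<and> (\<forall>y. y \<in> V \<longrightarrow> dim (range (g' y)) \<le> dim (range (g' x)))"
      by (rule ex_has_greatest_nat[of _ v _ "DIM('b) + 1"])
        (use \<open>v \<in> V\<close> dim_subset_UNIV in \<open>auto simp: less_Suc_eq_le\<close>)
    then show ?thesis using that by blast
  qed
  define A where "A = g' x0"
  have linA: "linear A" unfolding A_def by (rule lin)
  obtain P where P: "linear P" and APA: "\<And>x. A (P (A x)) = A x"
    using real_vector.linear_exists_right_inverse_on[OF linA subspace_UNIV] by auto
  define \<phi> where "\<phi> x = P (g x) + x - P (A x)" for x
  define D where "D x h = P (g' x h) + h - P (A h)" for x h
  have bP: "bounded_linear P" and bA: "bounded_linear A" and bg: "bounded_linear (g' x)" for x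
    using P linA lin by (simp_all add: linear_conv_bounded_linear)
  have bD: "bounded_linear (D x)" for x
    unfolding D_def
    by (intro bounded_linear_add bounded_linear_sub bounded_linear_ident
        bounded_linear_compose[OF bP] bg bA)
  have D: "(\<phi> has_derivative D x) (at x)" for x
    unfolding \<phi>_def D_def
    by (intro has_derivative_diff has_derivative_add has_derivative_ident
        bounded_linear.has_derivative[OF bP] bounded_linear_imp_has_derivative[OF bA] g_deriv)
  \<comment> \<open>Because of \<open>APA\<close>, the term \<open>h - P (A h)\<close> of
    \<open>D x h\<close> is invisible to \<open>A\<close>.\<close>
  have AD: "A (D x w) = A (P (g' x w))" for x w
    unfolding D_def using APA by (simp add: linear_add[OF linA] linear_diff[OF linA])
  have contD: "continuous_on V (\<lambda>x. Blinfun (D x))"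
  proof (rule continuous_on_blinfun_componentwise)
    fix i :: 'a
    have "continuous_on V (\<lambda>x. P (g' x i) + i - P (A i))"
      by (intro continuous_intros bounded_linear.continuous_on[OF bP]
          continuous_on_subset[OF g'_cont]) auto
    then show "continuous_on V (\<lambda>x. blinfun_apply (Blinfun (D x)) i)"
      by (simp add: bounded_linear_Blinfun_apply[OF bD] D_def)
  qed
  \<comment> \<open>At \<open>x0\<close> the two terms with \<open>P\<close> cancel, so the inverse
    function theorem applies with derivative the identity.\<close>
  have "D x0 h = h" for h unfolding D_def by (simp add: A_def)
  then have inv0: "id_blinfun o\<^sub>L Blinfun (D x0) = id_blinfun"
    by (intro blinfun_eqI) (simp add: bounded_linear_Blinfun_apply[OF bD])
  have D': "(\<phi> has_derivative blinfun_apply (Blinfun (D x))) (at x)" for x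
    using D by (simp add: bounded_linear_Blinfun_apply[OF bD])
  obtain U' V' \<psi> \<psi>' where U': "open U'" "U' \<subseteq> V" "x0 \<in> U'" and V': "open V'" "\<phi> x0 \<in> V'"
    and hom: "homeomorphism U' V' \<phi> \<psi>"
    and \<psi>: "\<And>y. y \<in> V' \<Longrightarrow> (\<psi> has_derivative \<psi>' y) (at y)"
    and \<psi>': "\<And>y. y \<in> V' \<Longrightarrow> \<psi>' y = inv (D (\<psi> y))"
    and bij: "\<And>y. y \<in> V' \<Longrightarrow> bij (D (\<psi> y))"
    by (rule inverse_function_theorem[OF V(1) D' contD x0 inv0,
          unfolded bounded_linear_Blinfun_apply[OF bD]]) blast
  obtain \<epsilon> where \<epsilon>: "\<epsilon> > 0" "ball (\<phi> x0) \<epsilon> \<subseteq> V'"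
    using V' by (meson openE)
  \<comment> \<open>Points of \<open>W\<close> have their \<open>\<phi>\<close>-values in a convex
    subset of \<open>V'\<close>, so segments between these values stay in the domain of
    \<open>\<psi>\<close>.\<close>
  define W where "W = U' \<inter> \<phi> -` ball (\<phi> x0) \<epsilon>"
  have "continuous_on U' \<phi>" using hom by (rule homeomorphism_cont1)
  then have openW: "open W" unfolding W_def using U'(1) by (intro continuous_open_preimage) auto
  have x0W: "x0 \<in> W" using U' \<epsilon> by (simp add: W_def)
  \<comment> \<open>As \<open>D x\<close> is onto, \<open>AD\<close> shows that \<open>A\<close>
    after \<open>P\<close> maps the range of \<open>g' x\<close> onto the range of \<open>A\<close>.
    By maximality of the rank it is injective there, and it sends the vector in question to
    \<open>A v = 0\<close>.\<close>
  have ker: "g' (\<psi> y) (\<psi>' y v) = 0" if y: "y \<in> V'" and v: "A v = 0" for y v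
  proof -
    define x where "x = \<psi> y"
    have xV: "x \<in> V" using hom y U' unfolding homeomorphism_def x_def by blast
    have Dw: "D x (\<psi>' y v) = v"
      unfolding \<psi>'[OF y] x_def using bij[OF y] by (meson bij_inv_eq_iff)
    have "range A = (\<lambda>w. A (D x w)) ` UNIV"
      using bij[OF y] unfolding bij_def x_def by (metis image_image)
    also have "\<dots> = (\<lambda>z. A (P z)) ` range (g' x)" unfolding AD by auto
    finally have "dim (range (g' x)) \<le> dim ((\<lambda>z. A (P z)) ` range (g' x))"
      using max[OF xV] by (simp add: A_def)
    moreover have linAP: "linear (\<lambda>z. A (P z))" using linear_compose[OF P linA] by (simp add: o_def)
    ultimately have "inj_on (\<lambda>z. A (P z)) (range (g' x))"
      by (intro linear_inj_on_if_dim_image_ge linear_subspace_image lin) auto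
    moreover have "A (P (g' x (\<psi>' y v))) = A (P (g' x 0))"
      using AD[of x "\<psi>' y v"] Dw v linear_0[OF lin] linear_0[OF P] linear_0[OF linA] by simp
    ultimately have "g' x (\<psi>' y v) = g' x 0" by (meson inj_onD rangeI)
    then show ?thesis using linear_0[OF lin] by (simp add: x_def)
  qed
  \<comment> \<open>Equal values under \<open>A\<close> after \<open>P\<close> put
    \<open>\<phi> x2 - \<phi> x1\<close> into the kernel of \<open>A\<close>. By \<open>ker\<close>,
    \<open>g\<close> after \<open>\<psi>\<close> has derivative zero along the segment between the
    two points.\<close>
  have const: "g x1 = g x2" if x: "x1 \<in> W" "x2 \<in> W" and eq: "A (P (g x1)) = A (P (g x2))" for x1 x2
  proof -
    define y where "y t = \<phi> x1 + t *\<^sub>R (\<phi> x2 - \<phi> x1)" for t :: real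
    have A0: "A (\<phi> x2 - \<phi> x1) = 0"
      using eq APA by (simp add: \<phi>_def linear_diff[OF linA] linear_add[OF linA])
    have yV: "y t \<in> V'" if "t \<in> {0..1}" for t
    proof -
      have "y t = (1 - t) *\<^sub>R \<phi> x1 + t *\<^sub>R \<phi> x2" by (simp add: y_def algebra_simps)
      moreover have "\<phi> x1 \<in> ball (\<phi> x0) \<epsilon>" "\<phi> x2 \<in> ball (\<phi> x0) \<epsilon>" using x by (auto simp: W_def)
      ultimately have "y t \<in> ball (\<phi> x0) \<epsilon>"
        using that convex_ball[of "\<phi> x0" \<epsilon>] unfolding convex_alt by auto
      with \<epsilon> show ?thesis by blast
    qed
    have "((\<lambda>t. g (\<psi> (y t))) has_derivative (\<lambda>h. 0)) (at t within {0..1})" if t: "t \<in> {0..1}" for t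
    proof -
      have "(y has_derivative (\<lambda>h. h *\<^sub>R (\<phi> x2 - \<phi> x1))) (at t)"
        unfolding y_def by (auto intro!: derivative_eq_intros)
      from has_derivative_compose[OF has_derivative_compose[OF this \<psi>[OF yV[OF t]]] g_deriv]
      have "((\<lambda>t. g (\<psi> (y t))) has_derivative (\<lambda>h. g' (\<psi> (y t)) (\<psi>' (y t) (h *\<^sub>R (\<phi> x2 - \<phi> x1))))) (at t)" .
      moreover have "A (h *\<^sub>R (\<phi> x2 - \<phi> x1)) = 0" for h
        using A0 by (simp add: linear_scale[OF linA])
      ultimately show ?thesis using ker[OF yV[OF t]]
        by (simp add: has_derivative_at_withinI)
    qed
    from has_derivative_zero_unique[OF _ this, of 0 1] have "g (\<psi> (y 0)) = g (\<psi> (y 1))" by simp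
    moreover have "\<psi> (\<phi> x1) = x1" "\<psi> (\<phi> x2) = x2"
      using x hom unfolding homeomorphism_def W_def by auto
    ultimately show ?thesis by (simp add: y_def)
  qed
  have linAP: "linear (\<lambda>z. A (P z))" using linear_compose[OF P linA] by (simp add: o_def)
  \<comment> \<open>If \<open>A (P z) = 0\<close>, openness yields a point of \<open>W\<close> with
    value \<open>g x0 + s *\<^sub>R z\<close> for some \<open>s > 0\<close>. By \<open>const\<close>
    this value equals \<open>g x0\<close>, hence \<open>z = 0\<close>. An injective linear
    endomorphism is onto, and then so is \<open>A\<close>.\<close>
  have "inj (\<lambda>z. A (P z))"
  proof (rule linear_injective_0[OF linAP, THEN iffD2], intro allI impI)
    fix z assume z: "A (P z) = 0"
    obtain \<delta> where \<delta>: "\<delta> > 0" "ball (g x0) \<delta> \<subseteq> g ` W"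
      using g_open[OF openW] x0W by (meson openE imageI)
    define s where "s = \<delta> / (2 * (norm z + 1))"
    have "norm z + 1 > 0" by (simp add: add_nonneg_pos)
    then have s: "s > 0" using \<delta> by (simp add: s_def)
    have "s * norm z \<le> s * (norm z + 1)" using s by simp
    also have "\<dots> = \<delta> / 2" using \<open>norm z + 1 > 0\<close> by (simp add: s_def field_simps)
    also have "\<dots> < \<delta>" using \<delta> by simp
    finally have "g x0 + s *\<^sub>R z \<in> ball (g x0) \<delta>" using s by (simp add: dist_norm)
    then obtain x where x: "x \<in> W" "g x0 + s *\<^sub>R z = g x" using \<delta> by blast
    have "A (P (g x)) = A (P (g x0))"
      using z unfolding x(2)[symmetric] by (simp add: linear_add[OF linAP] linear_scale[OF linAP])
    from const[OF x(1) x0W this] x(2) s show "z = 0" by simp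
  qed
  then have "surj (\<lambda>z. A (P z))" by (rule linear_inj_imp_surj[OF linAP])
  then have "surj A" unfolding surj_def by blast
  then show ?thesis using x0 unfolding A_def by blast
qed

section \<open>Explicit balls in the image from an approximate right inverse\<close>

lemma norm_matrix_vector_mult_le:
  fixes A :: "real ^ 'n ^ 'm"
  shows "norm (A *v x) \<le> norm A * norm x"
proof -
  \<comment> \<open>The norm of a matrix is the Euclidean norm of its entries, so Cauchy-Schwarz is
    applied to each row.\<close>
  have "norm (A *v x) = L2_set (\<lambda>i. \<bar>A $ i \<bullet> x\<bar>) UNIV"
    by (simp add: norm_vec_def matrix_vector_mul_component)
  also have "\<dots> \<le> L2_set (\<lambda>i. norm (A $ i) * norm x) UNIV"
    by (rule L2_set_mono) (simp_all add: Cauchy_Schwarz_ineq2)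
  also have "\<dots> = norm A * norm x"
    by (simp add: norm_vec_def L2_set_left_distrib)
  finally show ?thesis .
qed

text \<open>Solving \<open>g (q + B *v z) = y\<close> means finding a fixed point of
  \<open>T z = z - g (q + B *v z) + y\<close>. By \<open>approx\<close> its derivative has norm at
  most \<open>1/2\<close>, and since \<open>T 0\<close> has norm at most \<open>s / 2\<close>,
  \<open>T\<close> maps \<open>cball 0 s\<close> into itself.\<close>

lemma cball_subset_image:
  fixes g :: "real ^ 'n \<Rightarrow> real ^ 'm" and B :: "real ^ 'm ^ 'n"
  assumes g_deriv: "\<And>x. (g has_derivative (\<lambda>v. g' x *v v)) (at x)"
    and approx: "\<And>x z. x \<in> cball q r \<Longrightarrow> norm (g' x *v (B *v z) - z) \<le> norm z / 2"
    and s: "0 \<le> s" "norm B * s \<le> r"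
  shows "cball (g q) (s / 2) \<subseteq> g ` cball q r"
proof
  fix y assume y: "y \<in> cball (g q) (s / 2)"
  define T where "T z = z - g (q + B *v z) + y" for z
  have inr: "q + B *v z \<in> cball q r" if "z \<in> cball 0 s" for z
  proof -
    have "norm (B *v z) \<le> norm B * norm z" by (rule norm_matrix_vector_mult_le)
    also have "\<dots> \<le> norm B * s" using that by (intro mult_left_mono) auto
    finally show ?thesis using s by (simp add: dist_norm)
  qed
  have T: "(T has_derivative (\<lambda>h. h - g' (q + B *v z) *v (B *v h))) (at z within cball 0 s)" for z
    unfolding T_def
    by (auto intro!: derivative_eq_intros has_derivative_compose[OF _ g_deriv]
        bounded_linear_imp_has_derivative)
  have lip: "dist (T a) (T b) \<le> 1 / 2 * dist a b" if "a \<in> cball 0 s" "b \<in> cball 0 s" for a b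
    unfolding dist_norm
  proof (rule differentiable_bound[OF convex_cball T _ that])
    fix z :: "real ^ 'm" assume "z \<in> cball 0 s"
    from approx[OF inr[OF this]]
    show "onorm (\<lambda>h. h - g' (q + B *v z) *v (B *v h)) \<le> 1 / 2"
      by (intro onorm_le) (simp add: norm_minus_commute)
  qed
  have "\<exists>!z\<in>cball 0 s. T z = z"
  proof (rule Banach_fix[of _ "1/2"])
    show "T ` cball 0 s \<subseteq> cball 0 s"
    proof
      fix w assume "w \<in> T ` cball 0 s"
      then obtain z where z: "z \<in> cball 0 s" "w = T z" by blast
      have "norm (T z) \<le> dist (T z) (T 0) + norm (T 0)"
        by (metis dist_norm norm_triangle_sub add.commute)
      also have "\<dots> \<le> 1 / 2 * dist z 0 + s / 2"
        using y lip[OF z(1), of 0] s by (intro add_mono) (auto simp: T_def dist_norm norm_minus_commute)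
      also have "\<dots> \<le> s" using z by simp
      finally show "w \<in> cball 0 s" using z by simp
    qed
  qed (use s lip in \<open>auto simp: complete_eq_closed\<close>)
  then obtain z where "z \<in> cball 0 s" "T z = z" by blast
  then show "y \<in> g ` cball q r"
    using inr[of z] by (intro image_eqI[of _ _ "q + B *v z"]) (auto simp: T_def)
qed

section \<open>Rational approximation and effective data\<close>

lemma rat_dec_surj:
  assumes "x \<in> \<rat>" shows "\<exists>k. rat_dec k = x"
proof -
  obtain a b where b: "b > 0" and x: "x = of_int a / of_int b"
    using assms by (metis Rats_cases')
  have "rat_dec (prod_encode (int_encode a, nat b - 1)) = x"
    using b by (simp add: rat_dec_def x of_nat_diff)
  then show ?thesis by blast
qed

lemma nth0_list_decode_surj: "\<exists>k. \<forall>i::'n::finite. nth0 (list_decode k) (to_nat i) = f i"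
proof -
  \<comment> \<open>The list must reach every position \<open>to_nat i\<close>; its entries at other
    positions do not affect the claim.\<close>
  define L where "L = Suc (Max (range (to_nat :: 'n \<Rightarrow> nat)))"
  have "to_nat i < L" for i :: 'n unfolding L_def by (simp add: less_Suc_eq_le)
  then have "\<forall>i::'n. nth0 (list_decode (list_encode (map (\<lambda>j. f (from_nat j)) [0..<L]))) (to_nat i) = f i"
    by (simp add: nth0_def)
  then show ?thesis by blast
qed

lemma dist_vec_less:
  fixes x y :: "'a::metric_space ^ 'n::finite"
  assumes "\<And>i. dist (x $ i) (y $ i) < e / real CARD('n)"
  shows "dist x y < e"
proof -
  have "dist x y \<le> (\<Sum>i\<in>UNIV. dist (x $ i) (y $ i))"
    unfolding dist_vec_def by (rule L2_set_le_sum) simp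
  also have "\<dots> < (\<Sum>i\<in>(UNIV::'n set). e / real CARD('n))"
    by (rule sum_strict_mono) (use assms in auto)
  finally show ?thesis by simp
qed

lemma vec_dec_dense:
  fixes x :: "real ^ 'n::finite"
  assumes "e > 0" shows "\<exists>a. dist (vec_dec a) x < e"
proof -
  have "\<exists>k. dist (rat_dec k) y < e / real CARD('n)" for y
  proof -
    have "y < y + e / real CARD('n)" using assms by simp
    then obtain r where "r \<in> \<rat>" "y < r" "r < y + e / real CARD('n)"
      using Rats_dense_in_real by blast
    moreover obtain k where "rat_dec k = r" using rat_dec_surj[OF \<open>r \<in> \<rat>\<close>] by blast
    ultimately have "dist (rat_dec k) y < e / real CARD('n)" by (simp add: dist_real_def)
    then show ?thesis by blast
  qed
  then have "\<forall>i. \<exists>k. dist (rat_dec k) (x $ i) < e / real CARD('n)" by blast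
  from choice[OF this] obtain f where f: "\<And>i. dist (rat_dec (f i)) (x $ i) < e / real CARD('n)"
    by blast
  obtain a where "\<And>i::'n. nth0 (list_decode a) (to_nat i) = f i"
    using nth0_list_decode_surj[of f] by blast
  then have "dist (vec_dec a) x < e" by (intro dist_vec_less) (simp add: vec_dec_def f)
  then show ?thesis by blast
qed

lemma mat_dec_dense:
  fixes A :: "real ^ 'n::finite ^ 'm::finite"
  assumes "e > 0" shows "\<exists>a. dist (mat_dec a) A < e"
proof -
  have "\<exists>k. dist (vec_dec k) (A $ i) < e / real CARD('m)" for i
    using assms by (intro vec_dec_dense) simp
  then obtain f where f: "\<And>i. dist (vec_dec (f i)) (A $ i) < e / real CARD('m)" by metis
  obtain a where "\<And>i::'m. nth0 (list_decode a) (to_nat i) = f i"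
    using nth0_list_decode_surj[of f] by blast
  then have "dist (mat_dec a) A < e" by (intro dist_vec_less[of "mat_dec a"]) (simp add: mat_dec_def f)
  then show ?thesis by blast
qed

text \<open>The use principle at rational points: a computation on the constant name of \<open>vec_dec a\<close>
  that has looked at the first \<open>N\<close> entries only is also valid for every point within distance
  \<open>(1/2) ^ N\<close>, since such a point has a name starting with \<open>N\<close> copies of \<open>a\<close>.\<close>

lemma type2_computable_rho_bounded_eval:
  fixes f :: "real ^ 'n::finite \<Rightarrow> 'b::metric_space"
  assumes "type2_computable rho (cauchy_name \<nu>) f UNIV"
  obtains c where
    "\<And>a N k v x. \<lbrakk>bounded_eval N a c (list_encode [k]) = Suc v; dist (vec_dec a) x \<le> (1/2) ^ N\<rbrakk>
      \<Longrightarrow> dist (\<nu> v) (f x) \<le> (1/2) ^ k"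
    "\<And>a k. \<forall>\<^sub>F N in sequentially. bounded_eval N a c (list_encode [k]) > 0"
proof -
  obtain c where c: "\<And>p x. rho p x \<Longrightarrow>
      \<exists>q. (\<forall>k. rf_eval p c [k] (q k)) \<and> cauchy_name \<nu> q (f x)"
    using assms unfolding type2_computable_def by auto
  show ?thesis
  proof
    fix a N k v and x :: "real ^ 'n"
    assume ev: "bounded_eval N a c (list_encode [k]) = Suc v" and x: "dist (vec_dec a) x \<le> (1/2) ^ N"
    have "\<exists>b. dist (vec_dec b) x \<le> (1/2) ^ i" for i :: nat
      using vec_dec_dense[of "(1/2) ^ i" x] by (auto intro: less_imp_le)
    then obtain d where d: "\<And>i. dist (vec_dec (d i)) x \<le> (1/2) ^ i" by metis
    define p where "p i = (if i < N then a else d i)" for i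
    have "dist (vec_dec (p i)) x \<le> (1/2) ^ i" for i
    proof (cases "i < N")
      case True
      then have "(1/2::real) ^ N \<le> (1/2) ^ i" by (intro power_decreasing) auto
      with x have "dist (vec_dec a) x \<le> (1/2) ^ i" by (rule order_trans)
      with True show ?thesis by (simp add: p_def)
    qed (use d in \<open>simp add: p_def\<close>)
    then have "rho p x" by (simp add: cauchy_name_def)
    from c[OF this] obtain q where q: "rf_eval p c [k] (q k)" "cauchy_name \<nu> q (f x)" by blast
    from bounded_eval_consistent[OF q(1), of N a] have "q k = v" using ev by (simp add: p_def)
    with q(2) show "dist (\<nu> v) (f x) \<le> (1/2) ^ k" unfolding cauchy_name_def by blast
  next
    fix a k
    \<comment> \<open>The constant sequence names the rational point itself, so the program halts on
      it.\<close>
    have "rho (\<lambda>_. a) (vec_dec a :: real ^ 'n)" by (simp add: cauchy_name_def)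
    from c[OF this] obtain y where "rf_eval (\<lambda>_. a) c [k] y" by blast
    from eventually_bounded_eval[OF this]
    show "\<forall>\<^sub>F N in sequentially. bounded_eval N a c (list_encode [k]) > 0"
      by eventually_elim simp
  qed
qed

text \<open>Half of the contraction budget \<open>1/2\<close> pays for \<open>MB\<close>, the other
  half for replacing \<open>g' x\<close> by \<open>M\<close>, as
  \<open>(1/2) ^ k * 2 ^ \<beta> \<le> 1/4\<close>. With \<open>s = (1/2) ^ (t + \<beta>)\<close>
  the image covers radius \<open>s / 2\<close> around \<open>g q\<close>; the error of
  \<open>y\<close> and the radius of the ball take \<open>s / 4\<close> each.\<close>

lemma ball_subset_image_of_approx_right_inverse:
  fixes g :: "real ^ 'n::finite \<Rightarrow> real ^ 'm::finite" and B :: "real ^ 'm ^ 'n"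
  assumes g_deriv: "\<And>x. (g has_derivative (\<lambda>v. g' x *v v)) (at x)"
    and M: "\<And>x. x \<in> cball q ((1/2) ^ t) \<Longrightarrow> dist M (g' x) \<le> (1/2) ^ k"
    and MB: "norm (M ** B - mat 1) \<le> 1/4"
    and B: "norm B \<le> 2 ^ \<beta>" and k: "\<beta> + 2 \<le> k"
    and y: "dist y (g q) \<le> (1/2) ^ (t + \<beta> + 2)"
  shows "ball y ((1/2) ^ (t + \<beta> + 2)) \<subseteq> g ` cball q ((1/2) ^ t)"
proof -
  have "cball (g q) ((1/2) ^ (t + \<beta>) / 2) \<subseteq> g ` cball q ((1/2) ^ t)"
  proof (rule cball_subset_image[OF g_deriv])
    fix x z assume x: "x \<in> cball q ((1/2) ^ t)"
    have "g' x *v (B *v z) - z = (g' x - M) *v (B *v z) + (M ** B - mat 1) *v z"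
      by (simp add: matrix_vector_mult_diff_rdistrib flip: matrix_vector_mul_assoc)
    then have "norm (g' x *v (B *v z) - z)
        \<le> norm ((g' x - M) *v (B *v z)) + norm ((M ** B - mat 1) *v z)"
      by (metis norm_triangle_ineq)
    also have "\<dots> \<le> norm (g' x - M) * (norm B * norm z) + norm (M ** B - mat 1) * norm z"
      by (intro add_mono norm_matrix_vector_mult_le
          order_trans[OF norm_matrix_vector_mult_le mult_left_mono]) auto
    also have "\<dots> \<le> (1/2) ^ k * (2 ^ \<beta> * norm z) + 1/4 * norm z"
      using M[OF x] MB B by (intro add_mono mult_mono) (auto simp: dist_norm norm_minus_commute)
    also have "\<dots> \<le> (1/2) ^ (\<beta> + 2) * (2 ^ \<beta> * norm z) + 1/4 * norm z"
      using k by (intro add_mono mult_right_mono power_decreasing) auto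
    also have "\<dots> = norm z / 2"
      by (simp add: power_add power_one_over field_simps)
    finally show "norm (g' x *v (B *v z) - z) \<le> norm z / 2" .
  next
    have "norm B * (1/2) ^ (t + \<beta>) \<le> 2 ^ \<beta> * (1/2) ^ (t + \<beta>)"
      using B by (intro mult_right_mono) auto
    also have "\<dots> = (1/2) ^ t" by (simp add: power_add power_one_over)
    finally show "norm B * (1/2) ^ (t + \<beta>) \<le> (1/2) ^ t" .
  qed simp
  moreover have "ball y ((1/2) ^ (t + \<beta> + 2)) \<subseteq> cball (g q) ((1/2) ^ (t + \<beta>) / 2)"
  proof
    fix w assume "w \<in> ball y ((1/2) ^ (t + \<beta> + 2))"
    then have "dist y w \<le> (1/2) ^ (t + \<beta> + 2)" by simp
    with y have "dist (g q) w \<le> 2 * (1/2) ^ (t + \<beta> + 2)"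
      using dist_triangle2[of "g q" w y] by (simp add: dist_commute)
    then show "w \<in> cball (g q) ((1/2) ^ (t + \<beta>) / 2)" by simp
  qed
  ultimately show ?thesis by blast
qed

section \<open>Effective tests on rational data\<close>

lemma norm_vec_power2:
  fixes x :: "'a::real_inner ^ 'n::finite"
  shows "(norm x)\<^sup>2 = (\<Sum>i\<in>UNIV. (norm (x $ i))\<^sup>2)"
  by (simp add: power2_norm_eq_inner inner_vec_def)

text \<open>Squared norms are polynomials in the entries and stay rational; norms themselves would
  need roots. Hence all later tests compare squares.\<close>

lemma rat_computable_norm_vec:
  fixes v :: "(nat \<Rightarrow> nat) \<Rightarrow> nat \<Rightarrow> real ^ 'n::finite"
  assumes "\<And>i. rat_computable (\<lambda>p x. v p x $ i)"
  shows "rat_computable (\<lambda>p x. (norm (v p x))\<^sup>2)"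
  unfolding norm_vec_power2 real_norm_def power2_abs
  by (intro rat_computable_sum rat_computable_power2 assms)

lemma rat_computable_norm_mat:
  fixes v :: "(nat \<Rightarrow> nat) \<Rightarrow> nat \<Rightarrow> real ^ 'n::finite ^ 'm::finite"
  assumes "\<And>i j. rat_computable (\<lambda>p x. v p x $ i $ j)"
  shows "rat_computable (\<lambda>p x. (norm (v p x))\<^sup>2)"
  unfolding norm_vec_power2[where 'a = "real ^ 'n"]
  by (intro rat_computable_sum rat_computable_norm_vec assms)

lemma rat_computable_vec_dec:
  assumes "total_computable F" shows "rat_computable (\<lambda>p x. vec_dec (F p x) $ i)"
  unfolding vec_dec_def vec_lambda_beta
  by (intro rat_computable_rat_dec total_computable_nth0 assms)

lemma rat_computable_mat_dec:
  assumes "total_computable F" shows "rat_computable (\<lambda>p x. mat_dec (F p x) $ i $ j)"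
  unfolding mat_dec_def vec_lambda_beta
  by (intro rat_computable_vec_dec total_computable_nth0 assms)

lemma continuous_on_matrix_mult_const:
  fixes B :: "real ^ 'k::finite ^ 'n::finite" and f :: "'a::topological_space \<Rightarrow> real ^ 'n ^ 'm::finite"
  assumes "continuous_on S f" shows "continuous_on S (\<lambda>x. f x ** B)"
  unfolding matrix_matrix_mult_def by (intro continuous_intros assms)

lemma closure_image_eqI:
  fixes g :: "'a::euclidean_space \<Rightarrow> 'b::euclidean_space"
  assumes "continuous_on UNIV g" "bounded U"
    and "V \<subseteq> g ` U" "g ` U \<subseteq> closure V"
  shows "closure V = g ` closure U"
proof
  have cont: "continuous_on (closure U) g" using assms(1) continuous_on_subset by blast
  have "closed (g ` closure U)"
    using assms(2) cont by (intro compact_imp_closed compact_continuous_image) (auto simp: compact_closure)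
  moreover have "V \<subseteq> g ` closure U" using assms(3) closure_subset by blast
  ultimately show "closure V \<subseteq> g ` closure U" by (rule closure_minimal[rotated])
  show "g ` closure U \<subseteq> closure V"
    using cont assms(4) by (intro image_closure_subset) auto
qed

theorem theorem7:
  fixes g :: "real ^ 'n::finite \<Rightarrow> real ^ 'm::finite"
    and g' :: "real ^ 'n \<Rightarrow> real ^ 'n ^ 'm"
  assumes g_comp: "type2_computable rho rho g UNIV"
    and g_open: "\<forall>U. open U \<longrightarrow> open (g ` U)"
    and g_deriv: "\<forall>x. (g has_derivative (\<lambda>v. g' x *v v)) (at x)"
    and g'_cont: "continuous_on UNIV g'"
    and g'_comp: "type2_computable rho rho_mat g' UNIV"
  shows "type2_computable theta_bar_lt theta_bar_lt (\<lambda>R. g ` R)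
           {R. bounded R \<and> regular_closed R}"
proof -
  obtain c where c: "\<And>a N k v x. \<lbrakk>bounded_eval N a c (list_encode [k]) = Suc v;
        dist (vec_dec a) x \<le> (1/2) ^ N\<rbrakk> \<Longrightarrow> dist (vec_dec v) (g x) \<le> (1/2) ^ k"
    and c_conv: "\<And>a k. \<forall>\<^sub>F N in sequentially. bounded_eval N a c (list_encode [k]) > 0"
    using type2_computable_rho_bounded_eval[OF g_comp] by blast
  obtain c' where c': "\<And>a N k v x. \<lbrakk>bounded_eval N a c' (list_encode [k]) = Suc v;
        dist (vec_dec a) x \<le> (1/2) ^ N\<rbrakk> \<Longrightarrow> dist (mat_dec v) (g' x) \<le> (1/2) ^ k"
    and c'_conv: "\<And>a k. \<forall>\<^sub>F N in sequentially. bounded_eval N a c' (list_encode [k]) > 0"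
    using type2_computable_rho_bounded_eval[OF g'_comp] by blast
  have cont: "continuous_on UNIV g"
    using g_deriv by (meson continuous_at_imp_continuous_on has_derivative_continuous)

  \<comment> \<open>A candidate \<open>x\<close> codes a list \<open>[i, a, b, \<beta>, k, N, t, N']\<close>: index of a listed ball, rational
    point, approximate right inverse and exponent bounding its norm, precision and oracle bound for
    \<open>g'\<close>, exponent of the radius around the point, oracle bound for \<open>g\<close>.\<close>
  define arg where "arg j x = nth0 (list_decode x) j" for j x
  \<comment> \<open>This is the exponent \<open>t + \<beta> + 2\<close> of the covering estimate,
    used both as the precision of the centre and for the radius of the output ball.\<close>
  define L where "L x = arg 6 x + arg 3 x + 2" for x
  define Mcode where "Mcode x = bounded_eval (arg 5 x) (arg 1 x) c' (list_encode [arg 4 x])" for x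
  define ycode where "ycode x = bounded_eval (arg 7 x) (arg 1 x) c (list_encode [L x])" for x
  define B :: "nat \<Rightarrow> real ^ 'm ^ 'n" where "B x = mat_dec (arg 2 x)" for x
  define M :: "nat \<Rightarrow> real ^ 'n ^ 'm" where "M x = mat_dec (Mcode x - 1)" for x
  define q :: "nat \<Rightarrow> real ^ 'n" where "q x = vec_dec (arg 1 x)" for x
  define ctr :: "(nat \<Rightarrow> nat) \<Rightarrow> nat \<Rightarrow> real ^ 'n" where "ctr p x = vec_dec (pfst (p (arg 0 x)))" for p x
  define rad where "rad p x = rat_dec (psnd (p (arg 0 x)))" for p x
  \<comment> \<open>Both evaluations have succeeded; \<open>N \<le> t\<close> makes
    \<open>M x\<close> valid on the whole ball around \<open>q x\<close>; then come the bounds of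
    the covering estimate, squared. The last two clauses put that ball inside the listed one, and
    positivity of the difference is what allows the roots to be taken.\<close>
  define ok where "ok p x \<longleftrightarrow> 0 < Mcode x \<and> 0 < ycode x \<and> arg 5 x \<le> arg 6 x \<and>
      arg 3 x + 2 \<le> arg 4 x \<and> (norm (M x ** B x - mat 1))\<^sup>2 \<le> (1/2) ^ 4 \<and>
      (norm (B x))\<^sup>2 \<le> real (2 ^ (arg 3 x + arg 3 x)) \<and> (1/2) ^ arg 6 x < rad p x \<and>
      (norm (q x - ctr p x))\<^sup>2 < (rad p x - (1/2) ^ arg 6 x)\<^sup>2" for p x
  \<comment> \<open>The second component codes the radius \<open>1 / 2 ^ L x\<close>, with
    \<open>- 1\<close> because \<open>rat_dec\<close> adds one to the denominator. The default
    \<open>0\<close> codes a ball of radius zero, which is empty.\<close>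
  define F where "F p x = (if ok p x then
      prod_encode (ycode x - 1, prod_encode (int_encode 1, 2 ^ L x - 1)) else 0)" for p x

  have arg: "total_computable (\<lambda>p x. arg j x)" for j
    unfolding arg_def by (intro total_computable_nth0 total_computable_id)
  have L: "total_computable (\<lambda>p x. L x)"
    unfolding L_def by (intro total_computable_add arg total_computable_const)
  have Mcode: "total_computable (\<lambda>p x. Mcode x)" and ycode: "total_computable (\<lambda>p x. ycode x)"
    unfolding Mcode_def ycode_def list_encode.simps
    by (intro total_computable_bounded_eval arg L total_computable_Suc total_computable_prod_encode
        total_computable_const)+
  have B: "rat_computable (\<lambda>p x. B x $ i $ j)" and M: "rat_computable (\<lambda>p x. M x $ i' $ j')"
    for i j i' j'
    unfolding B_def M_def
    by (intro rat_computable_mat_dec arg total_computable_pred Mcode)+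
  have q: "rat_computable (\<lambda>p x. q x $ i)" and ctr: "rat_computable (\<lambda>p x. ctr p x $ i)" for i
    unfolding q_def ctr_def
    by (intro rat_computable_vec_dec total_computable_pfst total_computable_oracle arg)+
  have rad: "rat_computable rad"
    unfolding rad_def
    by (intro rat_computable_rat_dec total_computable_psnd total_computable_oracle arg)
  have const: "rat_computable (\<lambda>p x. real n)" for n
    by (intro rat_computable_of_nat total_computable_const)
  have "rat_computable (\<lambda>p x. (M x ** B x - mat 1) $ i $ j)" for i j
  proof -
    \<comment> \<open>The entries of the identity matrix are written as naturals so that
      \<open>const\<close> covers them.\<close>
    have "rat_computable (\<lambda>p x. (\<Sum>k\<in>UNIV. M x $ i $ k * B x $ k $ j) - real (of_bool (i = j)))"
      by (intro rat_computable_diff rat_computable_sum rat_computable_mult M B const)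
    then show ?thesis by (cases "i = j") (simp_all add: matrix_matrix_mult_def mat_def)
  qed
  moreover have "rat_computable (\<lambda>p x. (q x - ctr p x) $ i)" for i
    unfolding vector_minus_component by (intro rat_computable_diff q ctr)
  ultimately have "decidable ok"
    unfolding ok_def
    by (intro decidable_conj decidable_less decidable_le decidable_rat_le decidable_rat_less
        rat_computable_norm_mat rat_computable_norm_vec rat_computable_half_power
        rat_computable_power2 rat_computable_diff rat_computable_of_nat B rad
        total_computable_two_power total_computable_add total_computable_const arg Mcode ycode)
  then have "total_computable F"
    unfolding F_def
    by (intro total_computable_if total_computable_prod_encode total_computable_pred
        total_computable_diff total_computable_two_power total_computable_const L ycode)
  then obtain prog where prog: "\<And>p x. rf_eval p prog [x] (F p x)"
    unfolding total_computable_def by blast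

  have ball_F: "ball_dec (F p x) = (if ok p x then ball (vec_dec (ycode x - 1)) ((1/2) ^ L x) else {})"
    for p x
    by (auto simp: F_def ball_dec_def rat_dec_def of_nat_diff power_one_over
        int_decode_def[of 0] sum_decode_def)

  have ball_ctr: "ball_dec (p (arg 0 x)) = ball (ctr p x) (rad p x)" for p x
    by (simp add: ball_dec_def ctr_def rad_def pfst_def psnd_def split: prod.split)

  have ok_inner: "cball (q x) ((1/2) ^ arg 6 x) \<subseteq> ball_dec (p (arg 0 x))"
    and ok_sound: "ball_dec (F p x) \<subseteq> g ` cball (q x) ((1/2) ^ arg 6 x)" if ok: "ok p x" for p x
  proof -
    have "norm (q x - ctr p x) < rad p x - (1/2) ^ arg 6 x"
      using ok unfolding ok_def by (auto intro: power2_less_imp_less)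
    then have "dist (ctr p x) (q x) + (1/2) ^ arg 6 x < rad p x"
      by (simp add: dist_norm norm_minus_commute)
    then show "cball (q x) ((1/2) ^ arg 6 x) \<subseteq> ball_dec (p (arg 0 x))"
      unfolding ball_ctr using dist_triangle[of "ctr p x" _ "q x"]
      by (smt (verit) mem_ball mem_cball subsetI)
    have "Mcode x = Suc (Mcode x - 1)" "ycode x = Suc (ycode x - 1)" using ok by (auto simp: ok_def)
    note Suc = this[unfolded Mcode_def[of x] ycode_def[of x]]
    have "(1/2::real) ^ arg 6 x \<le> (1/2) ^ arg 5 x"
      using ok unfolding ok_def by (intro power_decreasing) auto
    then have "dist (vec_dec (arg 1 x)) z \<le> (1/2) ^ arg 5 x"
      if "z \<in> cball (q x) ((1/2) ^ arg 6 x)" for z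
      using that unfolding q_def mem_cball by (rule order_trans[rotated])
    then have "dist (M x) (g' z) \<le> (1/2) ^ arg 4 x" if "z \<in> cball (q x) ((1/2) ^ arg 6 x)" for z
      using c'[OF Suc(1), of z] that unfolding M_def Mcode_def by blast
    moreover have "(norm (M x ** B x - mat 1))\<^sup>2 \<le> (1/4)\<^sup>2"
      using ok by (simp add: ok_def power2_eq_square eval_nat_numeral)
    then have "norm (M x ** B x - mat 1) \<le> 1/4"
      by (rule power2_le_imp_le) simp
    moreover have "(norm (B x))\<^sup>2 \<le> (2 ^ arg 3 x)\<^sup>2"
      using ok by (simp add: ok_def power2_eq_square power_add)
    then have "norm (B x) \<le> 2 ^ arg 3 x"
      by (rule power2_le_imp_le) simp
    moreover have "arg 3 x + 2 \<le> arg 4 x" using ok by (simp add: ok_def)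
    moreover have "dist (vec_dec (ycode x - 1)) (g (q x)) \<le> (1/2) ^ (arg 6 x + arg 3 x + 2)"
      using c[OF Suc(2), of "q x"] by (simp add: q_def ycode_def L_def)
    ultimately show "ball_dec (F p x) \<subseteq> g ` cball (q x) ((1/2) ^ arg 6 x)"
      unfolding ball_F L_def if_P[OF ok]
      by (intro ball_subset_image_of_approx_right_inverse[OF g_deriv[rule_format]])
  qed

  \<comment> \<open>The data are chosen in order of dependence. A point of \<open>V\<close> with
    surjective derivative has a right inverse; openness makes first the inverse (\<open>b\<close>)
    and then the point (\<open>a\<close>) rational. Next come \<open>\<beta>\<close> and the
    precision \<open>k\<close>, then \<open>N\<close> for \<open>g'\<close>, then
    \<open>t \<ge> N\<close>, and finally \<open>N'\<close>, whose precision depends on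
    \<open>t\<close>.\<close>
  have dense: "\<exists>x. ok p x \<and> g ` cball (q x) ((1/2) ^ arg 6 x) \<subseteq> W"
    if z: "z \<in> ball_dec (p i)" and W: "open W" "g z \<in> W" for p i z W
  proof -
    define V where "V = ball_dec (p i) \<inter> g -` W"
    have "open (ball_dec (p i))" by (simp add: ball_dec_def split: prod.split)
    then have V: "open V" "V \<noteq> {}"
      using z W cont unfolding V_def by (auto intro: open_Int open_vimage)
    have "continuous_on UNIV (\<lambda>x. g' x *v h)" for h
      unfolding matrix_vector_mult_def by (intro continuous_intros g'_cont)
    from surj_derivative_dense[OF g_open[rule_format] g_deriv[rule_format] this V]
    obtain x1 where x1: "x1 \<in> V" "surj ((*v) (g' x1))" by blast
    then obtain B0 :: "real ^ 'm ^ 'n" where B0: "g' x1 ** B0 = mat 1"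
      using matrix_right_invertible_surjective by blast
    have "open {A :: real ^ 'm ^ 'n. norm (g' x1 ** A - mat 1) < 1/4}"
      unfolding matrix_matrix_mult_def by (intro open_Collect_less continuous_intros)
    moreover have "B0 \<in> \<dots>" using B0 by simp
    ultimately obtain e where "e > 0" and e: "ball B0 e \<subseteq> {A. norm (g' x1 ** A - mat 1) < 1/4}"
      by (rule openE)
    from mat_dec_dense[OF this(1), of B0] obtain b where "mat_dec b \<in> ball B0 e"
      by (auto simp: dist_commute)
    with e have b: "norm (g' x1 ** mat_dec b - mat 1) < 1/4" by blast

    have "open (V \<inter> {x. norm (g' x ** (mat_dec b :: real ^ 'm ^ 'n) - mat 1) < 1/4})"
      by (intro open_Int V open_Collect_less continuous_intros continuous_on_matrix_mult_const g'_cont)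
    moreover have "x1 \<in> \<dots>" using x1 b by simp
    ultimately obtain e where "e > 0"
      and e: "ball x1 e \<subseteq> V \<inter> {x. norm (g' x ** (mat_dec b :: real ^ 'm ^ 'n) - mat 1) < 1/4}"
      by (rule openE)
    from vec_dec_dense[OF this(1), of x1] obtain a where "vec_dec a \<in> ball x1 e"
      by (auto simp: dist_commute)
    with e have aV: "vec_dec a \<in> V" and a: "norm (g' (vec_dec a) ** mat_dec b - mat 1) < 1/4"
      by blast+

    obtain \<beta> :: nat where "norm (mat_dec b :: real ^ 'm ^ 'n) < 2 ^ \<beta>"
      using real_arch_pow[of 2] by auto
    then have \<beta>: "(norm (mat_dec b :: real ^ 'm ^ 'n))\<^sup>2 \<le> 2 ^ (\<beta> + \<beta>)"
      by (simp add: power_add power2_eq_square mult_mono)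

    \<comment> \<open>The test sees only a decoded approximation of the derivative, so the
      inequality must survive small changes of the matrix.\<close>
    have "open {A :: real ^ 'n ^ 'm. norm (A ** (mat_dec b :: real ^ 'm ^ 'n) - mat 1) < 1/4}"
      by (intro open_Collect_less continuous_intros continuous_on_matrix_mult_const)
    moreover have "g' (vec_dec a) \<in> \<dots>" using a by simp
    ultimately obtain \<delta> where "\<delta> > 0" and \<delta>: "ball (g' (vec_dec a)) \<delta> \<subseteq>
        {A. norm (A ** (mat_dec b :: real ^ 'm ^ 'n) - mat 1) < 1/4}"
      by (rule openE)
    obtain k0 :: nat where "(1/2) ^ k0 < \<delta>" using real_arch_pow_inv[OF \<open>\<delta> > 0\<close>, of "1/2"] by auto
    \<comment> \<open>The sum meets both the clause \<open>\<beta> + 2 \<le> k\<close> of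
      \<open>ok\<close> and the accuracy \<open>\<delta>\<close>; \<open>t = N + t0\<close> below is
      built in the same way.\<close>
    define k where "k = \<beta> + 2 + k0"
    have k: "(1/2) ^ k < \<delta>"
      by (rule le_less_trans[OF power_decreasing \<open>(1/2) ^ k0 < \<delta>\<close>]) (auto simp: k_def)

    obtain N where N: "bounded_eval N a c' (list_encode [k]) > 0"
      using eventually_happens[OF c'_conv[of a k]] by auto
    define v where "v = bounded_eval N a c' (list_encode [k]) - 1"
    have "bounded_eval N a c' (list_encode [k]) = Suc v" using N by (simp add: v_def)
    from c'[OF this, of "vec_dec a"] k have "mat_dec v \<in> ball (g' (vec_dec a)) \<delta>"
      by (simp add: dist_commute)
    with \<delta> have v: "norm (mat_dec v ** (mat_dec b :: real ^ 'm ^ 'n) - mat 1) < 1/4" by blast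

    define r where "r = rat_dec (psnd (p i))"
    define ct :: "real ^ 'n" where "ct = vec_dec (pfst (p i))"
    have "dist ct (vec_dec a) < r" using aV
      by (simp add: V_def ball_dec_def ct_def r_def pfst_def psnd_def split: prod.splits)
    moreover obtain \<epsilon> where "\<epsilon> > 0" "cball (vec_dec a) \<epsilon> \<subseteq> V"
      using V(1) aV open_contains_cball by blast
    ultimately obtain t0 :: nat where t0: "(1/2) ^ t0 < min \<epsilon> (r - dist ct (vec_dec a))"
      using real_arch_pow_inv[of "min \<epsilon> (r - dist ct (vec_dec a))" "1/2"] by auto
    define t where "t = N + t0"
    have "(1/2::real) ^ t \<le> (1/2) ^ t0" by (rule power_decreasing) (auto simp: t_def)
    with t0 have t: "(1/2) ^ t < \<epsilon>" "(1/2) ^ t + dist ct (vec_dec a) < r" by linarith+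

    obtain N' where N': "bounded_eval N' a c (list_encode [t + \<beta> + 2]) > 0"
      using eventually_happens[OF c_conv[of a "t + \<beta> + 2"]] by auto

    define x where "x = list_encode [i, a, b, \<beta>, k, N, t, N']"
    have args: "arg 0 x = i" "arg 1 x = a" "arg 2 x = b" "arg 3 x = \<beta>" "arg 4 x = k"
      "arg 5 x = N" "arg 6 x = t" "arg 7 x = N'"
      unfolding arg_def x_def list_encode_inverse by (simp_all add: nth0_def eval_nat_numeral)
    have "(norm (mat_dec v ** (mat_dec b :: real ^ 'm ^ 'n) - mat 1))\<^sup>2 \<le> (1/4)\<^sup>2"
      using v by (intro power_mono) auto
    moreover have "(norm (vec_dec a - ct))\<^sup>2 < (r - (1/2) ^ t)\<^sup>2"
      using t(2) by (intro power_strict_mono) (auto simp: dist_norm norm_minus_commute)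
    moreover have "(1/2) ^ t < r" using t(2) zero_le_dist[of ct "vec_dec a"] by linarith
    ultimately have "ok p x"
      using N N' \<beta> unfolding ok_def Mcode_def ycode_def L_def B_def M_def q_def ctr_def rad_def args
      by (simp add: k_def t_def v_def r_def ct_def power2_eq_square eval_nat_numeral)
    moreover have "cball (vec_dec a) ((1/2) ^ t) \<subseteq> V"
      using t(1) \<open>cball (vec_dec a) \<epsilon> \<subseteq> V\<close> by (meson less_imp_le subset_cball subset_trans)
    then have "g ` cball (q x) ((1/2) ^ arg 6 x) \<subseteq> W"
      unfolding q_def args by (auto simp: V_def)
    ultimately show ?thesis by blast
  qed

  show ?thesis
    unfolding type2_computable_def
  proof (intro exI[of _ prog] allI impI)
    fix p and R :: "(real ^ 'n) set"
    assume "R \<in> {R. bounded R \<and> regular_closed R}" and "theta_bar_lt p R"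
    then have "bounded R" and R: "closure (\<Union>k. ball_dec (p k)) = R"
      by (auto simp: theta_bar_lt_def theta_lt_def)
    then have bdd: "bounded (\<Union>k. ball_dec (p k) :: (real ^ 'n) set)"
      by (metis bounded_subset closure_subset)
    have "closure (\<Union>x. ball_dec (F p x)) = g ` R"
    proof (rule closure_image_eqI[OF cont bdd, unfolded R])
      show "(\<Union>x. ball_dec (F p x)) \<subseteq> g ` (\<Union>k. ball_dec (p k))"
      proof (rule UN_least)
        fix x
        show "ball_dec (F p x) \<subseteq> g ` (\<Union>k. ball_dec (p k))"
        proof (cases "ok p x")
          case True
          from ok_sound[OF this] ok_inner[OF this] show ?thesis by blast
        qed (simp add: ball_F)
      qed
      show "g ` (\<Union>k. ball_dec (p k)) \<subseteq> closure (\<Union>x. ball_dec (F p x))"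
      proof (intro image_subsetI)
        fix z :: "real ^ 'n" assume "z \<in> (\<Union>k. ball_dec (p k))"
        then obtain i where i: "z \<in> ball_dec (p i)" by blast
        show "g z \<in> closure (\<Union>x. ball_dec (F p x))"
          unfolding closure_iff_nhds_not_empty
        proof (intro allI impI)
          fix S T assume "T \<subseteq> S" "open T" "g z \<in> T"
          from dense[of z p i T, OF i this(2,3)] obtain x where x: "ok p x"
            "g ` cball (q x) ((1/2) ^ arg 6 x) \<subseteq> T" by blast
          \<comment> \<open>The certified ball contains its centre, so it is nonempty; lying inside
            \<open>T\<close>, it meets \<open>S\<close>.\<close>
          have "vec_dec (ycode x - 1) \<in> ball_dec (F p x)" using x(1) by (simp add: ball_F)
          then show "(\<Union>x. ball_dec (F p x)) \<inter> S \<noteq> {}"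
            using ok_sound[OF x(1)] x(2) \<open>T \<subseteq> S\<close> by blast
        qed
      qed
    qed
    then have "theta_bar_lt (F p) (g ` R)" by (auto simp: theta_bar_lt_def theta_lt_def)
    then show "\<exists>r. (\<forall>k. rf_eval p prog [k] (r k)) \<and> theta_bar_lt r (g ` R)"
      using prog by blast
  qed
qed

end
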